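(* Let $S$ be a finite commutative semigroup. Then $S$ has only countably many countable subdirect powers up to isomorphism if and only if $S$ is either an abelian group or a null semigroup. If $S$ is neither an abelian group nor a null semigroup, then $S$ has continuum many pairwise non-isomorphic countable subdirect powers, i.e. the number of isomorphism types of countable subdirect powers of $S$ is $\mathfrak{c}$.
   Context: Semigroups are non-empty. For a semigroup $S$ and a set $X$, the direct power $S^X$ is the semigroup of all functions $X\to S$ with multiplication $(fg)(x)=f(x)g(x)$. A subdirect power of $S$ is a subsemigroup $T$ of some direct power $S^X$ such that $\{f(x) : f\in T\}=S$ for every $x\in X$. It is called a countable subdirect power if the set $T$ is countable ($X$ need not be countable). "Countable" means finite or of cardinality $\aleph_0=|\mathbb{N}|$. The continuum $\mathfrak{c}$ is the cardinality of $\{0,1\}^{\mathbb{N}}$. A semigroup $S$ is null if there is an element $0\in S$ such that $st=0$ for all $s,t\in S$. *)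

theory Defs
  imports "HOL-Library.Equipollence"
begin

text \<open>
  A semigroup is given by an associative operation on a type (predicates
  \<^term>\<open>semigroup\<close>, \<^term>\<open>abel_semigroup\<close>, \<^term>\<open>group\<close> of the library); types are
  non-empty.  Elements of a direct power with index set \<open>X\<close> are the extensional functions
  on \<open>X\<close>, so that each function \<open>X \<rightarrow> S\<close> has a unique representative.  The index set may be empty.
\<close>

definition direct_power :: "'i set \<Rightarrow> ('i \<Rightarrow> 'a) set"
  where "direct_power X = X \<rightarrow>\<^sub>E UNIV"

definition power_mult ::
    "('a \<Rightarrow> 'a \<Rightarrow> 'a) \<Rightarrow> 'i set \<Rightarrow> ('i \<Rightarrow> 'a) \<Rightarrow> ('i \<Rightarrow> 'a) \<Rightarrow> ('i \<Rightarrow> 'a)"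
  where "power_mult m X f g = (\<lambda>x\<in>X. m (f x) (g x))"

definition subdirect_power ::
    "('a \<Rightarrow> 'a \<Rightarrow> 'a) \<Rightarrow> 'i set \<Rightarrow> ('i \<Rightarrow> 'a) set \<Rightarrow> bool"
  where "subdirect_power m X T \<longleftrightarrow>
    T \<noteq> {} \<and> T \<subseteq> direct_power X \<and>
    (\<forall>f\<in>T. \<forall>g\<in>T. power_mult m X f g \<in> T) \<and>
    (\<forall>x\<in>X. {f x | f. f \<in> T} = UNIV)"

definition semigroup_isomorphic ::
    "'b set \<Rightarrow> ('b \<Rightarrow> 'b \<Rightarrow> 'b) \<Rightarrow> 'c set \<Rightarrow> ('c \<Rightarrow> 'c \<Rightarrow> 'c) \<Rightarrow> bool"
  where "semigroup_isomorphic A f B g \<longleftrightarrow>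
    (\<exists>h. bij_betw h A B \<and> (\<forall>a\<in>A. \<forall>b\<in>A. h (f a b) = g (h a) (h b)))"

definition is_abelian_group :: "('a \<Rightarrow> 'a \<Rightarrow> 'a) \<Rightarrow> bool"
  where "is_abelian_group m \<longleftrightarrow> abel_semigroup m \<and> (\<exists>e i. group m e i)"

definition null_semigroup :: "('a \<Rightarrow> 'a \<Rightarrow> 'a) \<Rightarrow> bool"
  where "null_semigroup m \<longleftrightarrow> semigroup m \<and> (\<exists>z. \<forall>s t. m s t = z)"

text \<open>
  The index sets range over all subsets of the type \<open>'i\<close>.  The choice of \<open>'i\<close> is immaterial
  as long as it is infinite, see \<open>countable_subdirect_power_any_index_type\<close> below.
\<close>

definition countable_subdirect_powers ::
    "('a \<Rightarrow> 'a \<Rightarrow> 'a) \<Rightarrow> ('i set \<times> ('i \<Rightarrow> 'a) set) set"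
  where "countable_subdirect_powers m = {(X, T). subdirect_power m X T \<and> countable T}"

definition power_iso_rel ::
    "('a \<Rightarrow> 'a \<Rightarrow> 'a) \<Rightarrow>
     (('i set \<times> ('i \<Rightarrow> 'a) set) \<times> ('i set \<times> ('i \<Rightarrow> 'a) set)) set"
  where "power_iso_rel m =
    {((X, T), (Y, U)).
       (X, T) \<in> countable_subdirect_powers m \<and> (Y, U) \<in> countable_subdirect_powers m \<and>
       semigroup_isomorphic T (power_mult m X) U (power_mult m Y)}"

definition subdirect_power_iso_types ::
    "('a \<Rightarrow> 'a \<Rightarrow> 'a) \<Rightarrow> ('i set \<times> ('i \<Rightarrow> 'a) set) set set"
  where "subdirect_power_iso_types m = countable_subdirect_powers m // power_iso_rel m"

lemma semigroup_isomorphic_refl: "semigroup_isomorphic A f A f"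
  unfolding semigroup_isomorphic_def by (rule exI[of _ id]) auto

lemma semigroup_isomorphic_sym:
  assumes "semigroup_isomorphic A f B g" "\<And>a b. a \<in> A \<Longrightarrow> b \<in> A \<Longrightarrow> f a b \<in> A"
  shows "semigroup_isomorphic B g A f"
proof -
  obtain h where h: "bij_betw h A B" "\<forall>a\<in>A. \<forall>b\<in>A. h (f a b) = g (h a) (h b)"
    using assms(1) unfolding semigroup_isomorphic_def by blast
  let ?k = "inv_into A h"
  have k: "bij_betw ?k B A" using h(1) by (rule bij_betw_inv_into)
  have "?k (g a b) = f (?k a) (?k b)" if "a \<in> B" "b \<in> B" for a b
  proof -
    have ka: "?k a \<in> A" "?k b \<in> A" using k that by (auto dest: bij_betwE)
    have "h (?k a) = a" "h (?k b) = b" using h(1) that by (auto simp: bij_betw_inv_into_right)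
    then have "g a b = h (f (?k a) (?k b))" using h(2) ka by simp
    then show ?thesis using h(1) assms(2)[OF ka] by (simp add: bij_betw_inv_into_left)
  qed
  then show ?thesis unfolding semigroup_isomorphic_def using k by blast
qed

lemma semigroup_isomorphic_trans:
  assumes "semigroup_isomorphic A f B g" "semigroup_isomorphic B g C k"
  shows "semigroup_isomorphic A f C k"
proof -
  obtain h where h: "bij_betw h A B" "\<forall>a\<in>A. \<forall>b\<in>A. h (f a b) = g (h a) (h b)"
    using assms(1) unfolding semigroup_isomorphic_def by blast
  obtain h' where h': "bij_betw h' B C" "\<forall>a\<in>B. \<forall>b\<in>B. h' (g a b) = k (h' a) (h' b)"
    using assms(2) unfolding semigroup_isomorphic_def by blast
  have "\<forall>a\<in>A. \<forall>b\<in>A. (h' \<circ> h) (f a b) = k ((h' \<circ> h) a) ((h' \<circ> h) b)"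
    using h h' by (auto dest: bij_betwE)
  then show ?thesis
    unfolding semigroup_isomorphic_def using bij_betw_trans[OF h(1) h'(1)] by blast
qed

lemma equiv_power_iso_rel: "equiv (countable_subdirect_powers m) (power_iso_rel m)"
proof (rule equivI)
  show "power_iso_rel m \<subseteq> countable_subdirect_powers m \<times> countable_subdirect_powers m"
    by (auto simp: power_iso_rel_def)
  show "refl_on (countable_subdirect_powers m) (power_iso_rel m)"
    by (auto simp: refl_on_def power_iso_rel_def semigroup_isomorphic_refl)
  show "sym (power_iso_rel m)"
    unfolding sym_def power_iso_rel_def countable_subdirect_powers_def subdirect_power_def
    by clarsimp (rule semigroup_isomorphic_sym, assumption, simp)
  show "trans (power_iso_rel m)"
    unfolding trans_def power_iso_rel_def
    by clarsimp (rule semigroup_isomorphic_trans)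
qed

lemma countable_subdirect_power_any_index_type:
  fixes X :: "'j set" and T :: "('j \<Rightarrow> 'a) set"
  assumes inf: "infinite (UNIV :: 'i set)" and T: "subdirect_power m X T" and "countable T"
  shows "\<exists>(Y :: 'i set) U. subdirect_power m Y U \<and> countable U \<and>
           semigroup_isomorphic T (power_mult m X) U (power_mult m Y)"
proof -
  define p where "p = (\<lambda>(f, g). SOME x. x \<in> X \<and> f x \<noteq> (g x :: 'a))"
  have p: "p (f, g) \<in> X \<and> f (p (f, g)) \<noteq> g (p (f, g))" if "f \<in> T" "g \<in> T" "f \<noteq> g" for f g
  proof -
    have "f \<in> X \<rightarrow>\<^sub>E UNIV" "g \<in> X \<rightarrow>\<^sub>E UNIV"
      using T that unfolding subdirect_power_def direct_power_def by auto
    then have "\<exists>x. x \<in> X \<and> f x \<noteq> g x" using that(3) PiE_ext by metis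
    then show ?thesis unfolding p_def by (simp, rule someI_ex)
  qed
  define Z where "Z = p ` {(f, g). f \<in> T \<and> g \<in> T \<and> f \<noteq> g}"
  have "countable {(f, g). f \<in> T \<and> g \<in> T \<and> f \<noteq> g}"
    by (rule countable_subset[of _ "T \<times> T"]) (use assms(3) in auto)
  then have Zc: "countable Z" unfolding Z_def by (rule countable_image)
  have ZX: "Z \<subseteq> X" unfolding Z_def using p by auto
  obtain e0 :: "nat \<Rightarrow> 'i" where e0: "inj e0" using inf infinite_countable_subset by blast
  define e where "e = e0 \<circ> to_nat_on Z"
  have e: "inj_on e Z" unfolding e_def
    by (rule comp_inj_on[OF inj_on_to_nat_on[OF Zc] inj_on_subset[OF e0 subset_UNIV]])
  define d where "d = inv_into Z e"
  define Y where "Y = e ` Z"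
  have d: "d y \<in> Z" if "y \<in> Y" for y using that unfolding d_def Y_def by (rule inv_into_into)
  have de: "d (e z) = z" if "z \<in> Z" for z using that e unfolding d_def by simp
  define h where "h = (\<lambda>f :: 'j \<Rightarrow> 'a. \<lambda>y\<in>Y. f (d y))"
  have hom: "h (power_mult m X f g) = power_mult m Y (h f) (h g)" for f g
    using d ZX unfolding h_def power_mult_def by (auto simp: fun_eq_iff)
  have inj: "inj_on h T"
  proof (rule inj_onI, rule ccontr)
    fix f g assume fg: "f \<in> T" "g \<in> T" "h f = h g" "f \<noteq> g"
    then have z: "p (f, g) \<in> Z" unfolding Z_def by auto
    then have "e (p (f, g)) \<in> Y" unfolding Y_def by auto
    then have "f (p (f, g)) = g (p (f, g))"
      using fun_cong[OF fg(3), of "e (p (f, g))"] de[OF z] unfolding h_def by simp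
    then show False using p[OF fg(1,2,4)] by simp
  qed
  have "subdirect_power m Y (h ` T)"
    unfolding subdirect_power_def
  proof (intro conjI ballI)
    show "h ` T \<noteq> {}" using T unfolding subdirect_power_def by simp
    show "h ` T \<subseteq> direct_power Y" unfolding h_def direct_power_def by auto
    show "power_mult m Y f g \<in> h ` T" if mem: "f \<in> h ` T" "g \<in> h ` T" for f g
      proof -
      obtain f' g' where fg: "f' \<in> T" "f = h f'" "g' \<in> T" "g = h g'" using mem by blast
      then have "power_mult m X f' g' \<in> T" using T unfolding subdirect_power_def by simp
      then have "h (power_mult m X f' g') \<in> h ` T" by (rule imageI)
      then show ?thesis unfolding hom fg .
    qed
    show "{f y | f. f \<in> h ` T} = UNIV" if y: "y \<in> Y" for y
    proof -
      have "h f y = f (d y)" for f using y unfolding h_def by simp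
      then have "{f y | f. f \<in> h ` T} = {f (d y) | f. f \<in> T}" by (metis (lifting) image_iff)
      also have "\<dots> = UNIV" using T subsetD[OF ZX d[OF y]] unfolding subdirect_power_def by simp
      finally show ?thesis .
    qed
  qed
  moreover have "semigroup_isomorphic T (power_mult m X) (h ` T) (power_mult m Y)"
    unfolding semigroup_isomorphic_def using inj hom by (auto simp: bij_betw_def)
  ultimately show ?thesis using assms(3) by blast
qed

end

theory Submission
  imports Defs "HOL-Computational_Algebra.Primes"
begin

text \<open>
  Upper bounds come from data that determine the isomorphism type (\<open>iso_types_lepoll\<close>).  A null semigroup is determined by its
  cardinality.  A subdirect power \<open>T\<close> of a finite abelian group is an abelian group of bounded exponent,
  because inverses are powers.  By the theorem of Pruefer and Baer (\<open>bounded_group_has_basis\<close>) it is a direct sum of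
  cyclic groups.  Their orders are bounded, so for countable \<open>T\<close> the isomorphism type is given by finitely many
  multiplicities, each a natural number or infinite: there are only countably many types.  In general
  there are at most continuum many, by counting multiplication tables.

  Conversely, let \<open>S\<close> be neither a group nor null.  For every set \<open>M\<close> of natural numbers a countable
  subdirect power is built that contains the constants and from which \<open>M\<close> can be read off up to
  isomorphism.

  If \<open>S\<close> has two idempotents, choose \<open>z\<close> least and \<open>e\<close> minimal above it.  Then \<open>{z, e}\<close> is a two-element
  semilattice, and any intersection-closed family of sets can be planted as idempotents with values
  in \<open>{z, e}\<close>.  The invariant is the set of finite sizes of principal downsets of idempotents
  (\<open>continuum_lepoll_if_two_idempotents\<close>).

  If \<open>S\<close> has a single idempotent, it is a nilpotent extension of a group \<open>K\<close>.  There are then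
  distinct elements \<open>p\<close> and \<open>p'\<close> with the same products with all elements of \<open>S\<close>.  Replacing values \<open>p\<close>
  of a function by \<open>p'\<close> at chosen places gives classes of such indistinguishable elements of any
  prescribed finite size, and the invariant is the set of finite class sizes (\<open>continuum_lepoll_if_twins\<close>).
\<close>

section \<open>Bases of abelian groups of bounded exponent\<close>

text \<open>
  In a submonoid of exponent \<open>N\<close> the power \<open>x ^ (N - 1)\<close> is the inverse of \<open>x\<close>.  Working
  with submonoids of a commutative monoid therefore keeps all exponents natural numbers, and it
  fits subsemigroups of a power of a finite group, which are closed under inverses for this reason.
\<close>

context comm_monoid_mult
begin

text \<open>
  Independence is that of direct sums of cyclic groups: a relation between powers of the \<open>b\<close>
  is trivial factor by factor, although the exponents themselves may be non-zero.
\<close>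

definition independent :: "'a set \<Rightarrow> bool"
  where "independent B \<longleftrightarrow>
    (\<forall>F n. finite F \<longrightarrow> F \<subseteq> B \<longrightarrow> (\<Prod>b\<in>F. b ^ n b) = 1 \<longrightarrow> (\<forall>b\<in>F. b ^ n b = 1))"

definition power_products :: "'a set \<Rightarrow> 'a set"
  where "power_products B = {\<Prod>b\<in>F. b ^ n b | F n. finite F \<and> F \<subseteq> B}"

definition has_order :: "'a \<Rightarrow> nat \<Rightarrow> bool"
  where "has_order b d \<longleftrightarrow> (\<forall>n. b ^ n = 1 \<longleftrightarrow> d dvd n)"

lemma independentD:
  assumes "independent B" "finite F" "F \<subseteq> B" "(\<Prod>b\<in>F. b ^ n b) = 1" "b \<in> F"
  shows "b ^ n b = 1"
  using assms unfolding independent_def by blast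

lemma power_productsI: "finite F \<Longrightarrow> F \<subseteq> B \<Longrightarrow> (\<Prod>b\<in>F. b ^ n b) \<in> power_products B"
  unfolding power_products_def by blast

lemma has_orderD: "has_order b d \<Longrightarrow> b ^ n = 1 \<longleftrightarrow> d dvd n"
  unfolding has_order_def by blast

lemma has_order_unique: "has_order b d \<Longrightarrow> has_order b d' \<Longrightarrow> d = d'"
  using has_orderD[of b d d] has_orderD[of b d d'] has_orderD[of b d' d] has_orderD[of b d' d']
  by (simp add: dvd_antisym)

lemma prod_power: "(\<Prod>b\<in>F. h b) ^ n = (\<Prod>b\<in>F. h b ^ n)"
  by (induction F rule: infinite_finite_induct) (auto simp: power_mult_distrib)

lemma power_prod_mult:
  assumes "finite F" "finite G"
  shows "(\<Prod>b\<in>F. h b ^ n b) * (\<Prod>b\<in>G. h b ^ k b) =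
    (\<Prod>b\<in>F \<union> G. h b ^ ((if b \<in> F then n b else 0) + (if b \<in> G then k b else 0)))"
proof -
  have "(\<Prod>b\<in>F. h b ^ n b) = (\<Prod>b\<in>F \<union> G. h b ^ (if b \<in> F then n b else 0))"
    by (rule prod.mono_neutral_cong_left) (use assms in auto)
  moreover have "(\<Prod>b\<in>G. h b ^ k b) = (\<Prod>b\<in>F \<union> G. h b ^ (if b \<in> G then k b else 0))"
    by (rule prod.mono_neutral_cong_left) (use assms in auto)
  ultimately show ?thesis by (simp add: prod.distrib power_add)
qed

lemma power_prod_power: "(\<Prod>b\<in>F. h b ^ n b) ^ k = (\<Prod>b\<in>F. h b ^ (n b * k))"
  by (simp add: prod_power power_mult)

lemma power_swap: "(x ^ a) ^ b = (x ^ b) ^ a"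
  by (simp add: power_mult[symmetric] ac_simps)

lemma power_products_one: "1 \<in> power_products B"
  using power_productsI[of "{}" B] by simp

lemma power_products_base: "b \<in> B \<Longrightarrow> b \<in> power_products B"
  using power_productsI[of "{b}" B "\<lambda>_. 1"] by simp

lemma power_products_mult:
  assumes "x \<in> power_products B" "y \<in> power_products B"
  shows "x * y \<in> power_products B"
proof -
  obtain F n G k where *: "finite F" "F \<subseteq> B" "x = (\<Prod>b\<in>F. b ^ n b)"
    "finite G" "G \<subseteq> B" "y = (\<Prod>b\<in>G. b ^ k b)"
    using assms unfolding power_products_def by blast
  show ?thesis
    unfolding * power_prod_mult[OF *(1,4)] by (rule power_productsI) (use * in auto)
qed

lemma power_products_power: "x \<in> power_products B \<Longrightarrow> x ^ n \<in> power_products B"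
  by (induction n) (simp_all add: power_products_one power_products_mult)

lemma power_cancel:
  assumes "y ^ N = 1" "N > 0" "x * y ^ (N - 1) = 1"
  shows "x = y"
proof -
  have "y ^ (N - 1) * y = 1" using assms(1,2) power_minus_mult[of N y] by simp
  then have "x = x * (y ^ (N - 1) * y)" by simp
  also have "\<dots> = (x * y ^ (N - 1)) * y" by (simp only: mult.assoc)
  finally show ?thesis using assms(3) by simp
qed

text \<open>
  The universal property of a direct sum of cyclic groups.  Two products represent the same element
  iff the product of one with the \<open>(N - 1)\<close>-st power of the other is \<open>1\<close>, and such a relation is
  trivial factor by factor, so \<open>s\<close> preserves it.
\<close>

lemma hom_from_independent:
  fixes s :: "'a \<Rightarrow> 'a"
  assumes B: "independent B" and N: "N > 0"
    and ex: "\<And>b. b \<in> B \<Longrightarrow> b ^ N = 1"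
    and s: "\<And>b n. b \<in> B \<Longrightarrow> b ^ n = 1 \<Longrightarrow> s b ^ n = 1"
  obtains h where "\<And>F n. finite F \<Longrightarrow> F \<subseteq> B \<Longrightarrow> h (\<Prod>b\<in>F. b ^ n b) = (\<Prod>b\<in>F. s b ^ n b)"
proof -
  have wd: "(\<Prod>b\<in>F. s b ^ n b) = (\<Prod>b\<in>G. s b ^ k b)"
    if F: "finite F" "F \<subseteq> B" and G: "finite G" "G \<subseteq> B"
      and eq: "(\<Prod>b\<in>F. b ^ n b) = (\<Prod>b\<in>G. b ^ k b)" for F G n k
  proof (rule power_cancel)
    define e where "e b = (if b \<in> F then n b else 0) + (if b \<in> G then k b * (N - 1) else 0)" for b
    have pN: "b ^ (j * N) = 1" if "b ^ N = 1" for b j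
      using that power_swap[of b j N] by (simp add: power_mult)
    have "(\<Prod>b\<in>G. b ^ k b) ^ N = 1"
      unfolding power_prod_power using pN ex G(2) by (intro prod.neutral) blast
    then have "(\<Prod>b\<in>F. b ^ n b) * (\<Prod>b\<in>G. b ^ k b) ^ (N - 1) = 1"
      unfolding eq using N by (metis power_minus_mult mult.commute)
    then have one: "(\<Prod>b\<in>F \<union> G. b ^ e b) = 1"
      unfolding power_prod_power power_prod_mult[OF F(1) G(1), of "\<lambda>b. b"] e_def .
    have "b ^ e b = 1" if "b \<in> F \<union> G" for b
      using independentD[OF B _ _ one that] F G by blast
    then have "s b ^ e b = 1" if "b \<in> F \<union> G" for b
      using s that F G by blast
    then have "(\<Prod>b\<in>F \<union> G. s b ^ e b) = 1" by (simp add: prod.neutral)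
    then show "(\<Prod>b\<in>F. s b ^ n b) * (\<Prod>b\<in>G. s b ^ k b) ^ (N - 1) = 1"
      unfolding power_prod_power power_prod_mult[OF F(1) G(1)] e_def .
    show "(\<Prod>b\<in>G. s b ^ k b) ^ N = 1"
      unfolding power_prod_power using pN s ex G(2) by (intro prod.neutral) blast
  qed (rule N)
  define h where "h x = (SOME y. \<exists>F n. finite F \<and> F \<subseteq> B \<and> x = (\<Prod>b\<in>F. b ^ n b) \<and>
    y = (\<Prod>b\<in>F. s b ^ n b))" for x
  have "h (\<Prod>b\<in>F. b ^ n b) = (\<Prod>b\<in>F. s b ^ n b)" if "finite F" "F \<subseteq> B" for F n
    unfolding h_def
  proof (rule some_equality)
    show "\<exists>G k. finite G \<and> G \<subseteq> B \<and> (\<Prod>b\<in>F. b ^ n b) = (\<Prod>b\<in>G. b ^ k b) \<and>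
      (\<Prod>b\<in>F. s b ^ n b) = (\<Prod>b\<in>G. s b ^ k b)" using that by blast
  qed (use wd that in metis)
  then show ?thesis using that by blast
qed

text \<open>
  The homomorphisms that extend \<open>s\<close> and its inverse are inverse to each other.
\<close>

lemma isomorphic_of_bases:
  assumes B: "independent B" and C: "independent C" and N: "N > 0"
    and exB: "\<And>b. b \<in> B \<Longrightarrow> b ^ N = 1"
    and s: "bij_betw s B C" and ord: "\<And>b n. b \<in> B \<Longrightarrow> s b ^ n = 1 \<longleftrightarrow> b ^ n = 1"
  shows "semigroup_isomorphic (power_products B) (*) (power_products C) (*)"
proof -
  define t where "t = inv_into B s"
  have ts: "t (s b) = b" if "b \<in> B" for b
    using s that unfolding t_def by (simp add: bij_betw_inv_into_left)
  have t: "t c \<in> B" "s (t c) = c" if "c \<in> C" for c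
    using s that unfolding t_def
    by (auto simp: bij_betw_inv_into_right bij_betw_def inv_into_into)
  have sC: "s b \<in> C" if "b \<in> B" for b using s that by (auto dest: bij_betwE)
  have injs: "inj_on s F" if "F \<subseteq> B" for F using s that by (metis bij_betw_def inj_on_subset)
  have injt: "inj_on t G" if "G \<subseteq> C" for G using t that by (metis inj_onI subsetD)
  obtain h where h: "\<And>F n. finite F \<Longrightarrow> F \<subseteq> B \<Longrightarrow> h (\<Prod>b\<in>F. b ^ n b) = (\<Prod>b\<in>F. s b ^ n b)"
    using hom_from_independent[OF B N exB, of s] ord by blast
  have exC: "c ^ N = 1" if "c \<in> C" for c using ord[OF t(1)[OF that]] exB t that by metis
  have ordt: "t c ^ n = 1" if "c \<in> C" "c ^ n = 1" for c n using ord[OF t(1)] t that by metis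
  obtain k where k: "\<And>F n. finite F \<Longrightarrow> F \<subseteq> C \<Longrightarrow> k (\<Prod>b\<in>F. b ^ n b) = (\<Prod>b\<in>F. t b ^ n b)"
    using hom_from_independent[OF C N exC, of t] ordt by blast
  have h': "h (\<Prod>b\<in>F. b ^ n b) = (\<Prod>c\<in>s ` F. c ^ n (t c))" if "finite F" "F \<subseteq> B" for F n
  proof -
    have "(\<Prod>c\<in>s ` F. c ^ n (t c)) = (\<Prod>b\<in>F. s b ^ n (t (s b)))"
      using prod.reindex[OF injs[OF that(2)], of "\<lambda>c. c ^ n (t c)"] by simp
    also have "\<dots> = (\<Prod>b\<in>F. s b ^ n b)" by (rule prod.cong) (use ts that in auto)
    finally show ?thesis using h[OF that] by simp
  qed
  have k': "k (\<Prod>b\<in>F. b ^ n b) = (\<Prod>c\<in>t ` F. c ^ n (s c))" if "finite F" "F \<subseteq> C" for F n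
  proof -
    have "(\<Prod>c\<in>t ` F. c ^ n (s c)) = (\<Prod>b\<in>F. t b ^ n (s (t b)))"
      using prod.reindex[OF injt[OF that(2)], of "\<lambda>c. c ^ n (s c)"] by simp
    also have "\<dots> = (\<Prod>b\<in>F. t b ^ n b)" by (rule prod.cong) (use t that in auto)
    finally show ?thesis using k[OF that] by simp
  qed
  have hin: "h x \<in> power_products C \<and> k (h x) = x" if x: "x \<in> power_products B" for x
  proof -
    obtain F n where F: "finite F" "F \<subseteq> B" "x = (\<Prod>b\<in>F. b ^ n b)"
      using x unfolding power_products_def by blast
    have sub: "finite (s ` F)" "s ` F \<subseteq> C" using F sC by auto
    have im: "t ` s ` F = F" using ts F by force
    have "(\<Prod>c\<in>F. c ^ n (t (s c))) = x" unfolding F by (rule prod.cong) (use ts F in auto)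
    then show ?thesis
      using k'[OF sub, of "\<lambda>c. n (t c)"] h'[OF F(1,2), of n] power_productsI[OF sub] im F by simp
  qed
  have kin: "k x \<in> power_products B \<and> h (k x) = x" if x: "x \<in> power_products C" for x
  proof -
    obtain F n where F: "finite F" "F \<subseteq> C" "x = (\<Prod>b\<in>F. b ^ n b)"
      using x unfolding power_products_def by blast
    have sub: "finite (t ` F)" "t ` F \<subseteq> B" using F t by auto
    have im: "s ` t ` F = F" using t F by force
    have "(\<Prod>c\<in>F. c ^ n (s (t c))) = x" unfolding F by (rule prod.cong) (use t F in auto)
    then show ?thesis
      using h'[OF sub, of "\<lambda>c. n (s c)"] k'[OF F(1,2), of n] power_productsI[OF sub] im F by simp
  qed
  have "bij_betw h (power_products B) (power_products C)"
    by (rule bij_betw_byWitness[where f' = k]) (use hin kin in auto)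
  moreover have "h (x * y) = h x * h y" if xy: "x \<in> power_products B" "y \<in> power_products B" for x y
  proof -
    obtain F n G l where *: "finite F" "F \<subseteq> B" "x = (\<Prod>b\<in>F. b ^ n b)"
      "finite G" "G \<subseteq> B" "y = (\<Prod>b\<in>G. b ^ l b)"
      using xy unfolding power_products_def by blast
    show ?thesis
      using h[of "F \<union> G"] h[OF *(1,2)] h[OF *(4,5)] *
      by (simp add: power_prod_mult)
  qed
  ultimately show ?thesis unfolding semigroup_isomorphic_def by blast
qed

text \<open>
  If \<open>n\<close> is not a multiple of \<open>p\<close>, then \<open>x\<close> is a power of \<open>x ^ n\<close>.  A relation that involves
  such a power of \<open>x\<close> would thus express \<open>x\<close> through \<open>B\<close>.
\<close>

lemma independent_insert:
  assumes B: "independent B" and p: "prime p" and x: "x ^ p = 1" "x \<notin> power_products B"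
    and N: "N > 0" "\<And>y. y \<in> power_products B \<Longrightarrow> y ^ N = 1"
  shows "independent (insert x B)"
  unfolding independent_def
proof (intro allI impI)
  fix F :: "'a set" and n
  assume F: "finite F" "F \<subseteq> insert x B" and one: "(\<Prod>b\<in>F. b ^ n b) = 1"
  have sub: "F - {x} \<subseteq> B" "finite (F - {x})" using F by auto
  define y where "y = (\<Prod>b\<in>F - {x}. b ^ n b)"
  have y: "y \<in> power_products B" unfolding y_def by (rule power_productsI[OF sub(2,1)])
  have xn: "x ^ n x = 1" if "x \<in> F"
  proof (cases "p dvd n x")
    case True
    then show ?thesis using x(1) by (auto elim!: dvdE simp: power_mult)
  next
    case False
    have "x ^ n x * y = 1" using one prod.remove[OF F(1) that] unfolding y_def by simp
    then have "(x ^ n x * y) * y ^ (N - 1) = y ^ (N - 1)" by simp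
    moreover have "y * y ^ (N - 1) = 1" using N(1) N(2)[OF y] by (metis power_minus_mult mult.commute)
    ultimately have "x ^ n x = y ^ (N - 1)" by (simp add: mult.assoc)
    then have xB: "x ^ n x \<in> power_products B" using power_products_power[OF y] by simp
    have "coprime (n x) p" using False p prime_imp_coprime coprime_commute by blast
    then obtain r q where "n x * r = p * q + 1"
      using bezout_nat[of "n x" p] False by (metis coprime_imp_gcd_eq_1 dvd_0_right)
    then have "x ^ (n x * r) = x" using x(1) by (simp add: power_add power_mult)
    then have "x \<in> power_products B" using power_products_power[OF xB, of r] by (simp add: power_mult)
    then show ?thesis using x(2) by simp
  qed
  have "y = 1"
  proof (cases "x \<in> F")
    case True
    then show ?thesis using one prod.remove[OF F(1) True] xn[OF True] unfolding y_def by simp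
  qed (use one in \<open>simp add: y_def\<close>)
  then have "b ^ n b = 1" if "b \<in> F - {x}" for b
    using independentD[OF B sub(2,1) _ that] y_def by simp
  then show "\<forall>b\<in>F. b ^ n b = 1" using xn by blast
qed

lemma has_order_prime:
  assumes "prime p" "x ^ p = 1" "x \<noteq> 1"
  shows "has_order x p"
  unfolding has_order_def
proof (intro allI iffI)
  fix n assume n: "x ^ n = 1"
  show "p dvd n"
  proof (rule ccontr)
    assume F: "\<not> p dvd n"
    then have "coprime n p" using assms(1) prime_imp_coprime coprime_commute by blast
    then obtain r q where "n * r = p * q + 1"
      using bezout_nat[of n p] F by (metis coprime_imp_gcd_eq_1 dvd_0_right)
    then have "x ^ (n * r) = x" using assms(2) by (simp add: power_add power_mult)
    then show False using n assms(3) by (simp add: power_mult)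
  qed
qed (use assms in \<open>auto elim!: dvdE simp: power_mult\<close>)

text \<open>
  The choice of \<open>p\<close>-th roots that preserves independence.  If the order of \<open>c\<close> is a power of \<open>p\<close>,
  then \<open>c ^ n = 1\<close> forces \<open>p\<close> to divide \<open>n\<close>, and any root will do.  If it is coprime to \<open>p\<close>, the root
  has to be taken inside the cyclic group of \<open>c\<close>.  In both cases \<open>b ^ n\<close> is a power of \<open>c\<close>
  whenever \<open>c ^ n = 1\<close>, so that a relation between roots becomes a relation between the \<open>c\<close>.
\<close>

lemma root_of_prime_power_order:
  assumes p: "prime p" and c: "has_order c d" "d = q ^ k" "prime q" "k > 0"
    and x: "x ^ p = c"
  obtains b r where "b = x \<or> b = c ^ r" "b ^ p = c"
    "\<exists>q k. prime q \<and> k > 0 \<and> has_order b (q ^ k)"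
    "\<And>n. c ^ n = 1 \<Longrightarrow> b ^ n = c ^ (if p dvd d then n div p else 0)"
proof (cases "q = p")
  case True
  have d: "p dvd d" using True c by (simp add: dvd_power)
  have "has_order x (p * d)" unfolding has_order_def
  proof (intro allI iffI)
    fix n assume n: "x ^ n = 1"
    have "c ^ n = 1" unfolding x[symmetric] power_swap[of x p] n by (rule power_one)
    then have "p dvd n" using c(1) d has_orderD comm_monoid_mult_class.dvd_trans by blast
    then obtain n' where n': "n = p * n'" ..
    then have "c ^ n' = 1" using n x by (simp add: power_mult)
    then show "p * d dvd n" using has_orderD[OF c(1)] n' by simp
  next
    fix n assume "p * d dvd n"
    then obtain l where "n = p * d * l" ..
    then have l: "n = p * (d * l)" by simp
    have "c ^ (d * l) = 1" using has_orderD[OF c(1)] by simp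
    then show "x ^ n = 1" unfolding l power_mult[of x p] x .
  qed
  then have o: "has_order x (q ^ Suc k)" using True c(2) by simp
  have "x ^ n = c ^ (n div p)" if "c ^ n = 1" for n
  proof -
    have "p dvd n" using that c(1) d has_orderD comm_monoid_mult_class.dvd_trans by blast
    then obtain n' where "n = p * n'" ..
    then show ?thesis using x p by (simp add: power_mult prime_gt_0_nat)
  qed
  then show ?thesis using that[of x 0] x d o c(3) by (metis zero_less_Suc)
next
  case False
  have nd: "\<not> p dvd d" using False p c by (metis prime_dvd_power primes_dvd_imp_eq)
  then have "coprime p d" using p prime_imp_coprime by blast
  moreover have "p \<noteq> 0" using p by auto
  ultimately obtain r t where r: "p * r = d * t + 1"
    using bezout_nat[of p d] by (metis coprime_imp_gcd_eq_1)
  have "c ^ d = 1" using has_orderD[OF c(1)] by simp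
  then have "c ^ (p * r) = c" unfolding r by (simp add: power_add power_mult)
  then have rp: "(c ^ r) ^ p = c" unfolding power_swap[of c r] power_mult .
  have iff: "(c ^ r) ^ n = 1 \<longleftrightarrow> c ^ n = 1" for n
  proof
    assume "(c ^ r) ^ n = 1"
    then have "((c ^ r) ^ p) ^ n = 1" by (simp add: power_swap[of _ p])
    then show "c ^ n = 1" unfolding rp .
  qed (simp add: power_swap[of c r])
  have "has_order (c ^ r) (q ^ k)" using c(1,2) iff unfolding has_order_def by simp
  then show ?thesis using that[of "c ^ r" r] rp nd iff c(3,4) by auto
qed

lemma power_products_subset:
  assumes "B \<subseteq> T" "1 \<in> T" "\<forall>x\<in>T. \<forall>y\<in>T. x * y \<in> T"
  shows "power_products B \<subseteq> T"
proof -
  have pow: "x ^ n \<in> T" if "x \<in> T" for x n by (induction n) (use assms that in auto)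
  have "(\<Prod>b\<in>F. b ^ n b) \<in> T" if "finite F" "F \<subseteq> B" for F n
    using that by (induction F rule: finite_induct) (use assms pow in auto)
  then show ?thesis unfolding power_products_def by blast
qed

text \<open>
  Zorn's lemma, applied to the independent sets that arise from \<open>B0\<close> by adding elements of order \<open>p\<close>:
  by maximality and \<open>independent_insert\<close> every \<open>x\<close> with \<open>x ^ p = 1\<close> is generated.
\<close>

lemma extend_independent:
  assumes B0: "independent B0" "B0 \<subseteq> T" and p: "prime p" and N: "N > 0"
    and T: "1 \<in> T" "\<forall>x\<in>T. \<forall>y\<in>T. x * y \<in> T" "\<forall>x\<in>T. x ^ N = 1"
  obtains B where "B0 \<subseteq> B" "B \<subseteq> B0 \<union> {x \<in> T. has_order x p}" "independent B"
    "{x \<in> T. x ^ p = 1} \<subseteq> power_products B"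
proof -
  define \<A> where "\<A> = {B. B0 \<subseteq> B \<and> B \<subseteq> B0 \<union> {x \<in> T. has_order x p} \<and> independent B}"
  have "\<exists>M\<in>\<A>. \<forall>X\<in>\<A>. M \<subseteq> X \<longrightarrow> X = M"
  proof (rule subset_Zorn_nonempty)
    show "\<A> \<noteq> {}" using B0 unfolding \<A>_def by blast
    fix \<C> assume C: "\<C> \<noteq> {}" "subset.chain \<A> \<C>"
    then have sub: "\<C> \<subseteq> \<A>" unfolding subset.chain_def by blast
    have "independent (\<Union>\<C>)" unfolding independent_def
    proof (intro allI impI)
      fix F n assume F: "finite F" "F \<subseteq> \<Union>\<C>" "(\<Prod>b\<in>F. b ^ n b) = 1"
      obtain B where "B \<in> \<C>" "F \<subseteq> B" using finite_subset_Union_chain[OF F(1,2) C] .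
      then show "\<forall>b\<in>F. b ^ n b = 1"
        using F sub unfolding \<A>_def independent_def by blast
    qed
    then show "\<Union>\<C> \<in> \<A>" using sub C(1) unfolding \<A>_def by blast
  qed
  then obtain B where BA: "B \<in> \<A>" and max: "\<And>X. X \<in> \<A> \<Longrightarrow> B \<subseteq> X \<Longrightarrow> X = B" by blast
  have B: "B0 \<subseteq> B" "B \<subseteq> B0 \<union> {x \<in> T. has_order x p}" "independent B"
    using BA unfolding \<A>_def by auto
  have "B \<subseteq> T" using B B0 by blast
  then have exB: "y ^ N = 1" if "y \<in> power_products B" for y
    using power_products_subset[of B T] T that by blast
  have "x \<in> power_products B" if x: "x \<in> T" "x ^ p = 1" for x
  proof (rule ccontr)
    assume out: "x \<notin> power_products B"
    then have "x \<noteq> 1" using power_products_one by blast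
    then have "has_order x p" using has_order_prime p x by blast
    moreover have "independent (insert x B)"
      by (rule independent_insert[OF B(3) p x(2) out N exB])
    ultimately have "insert x B \<in> \<A>" using B x unfolding \<A>_def by blast
    then have "x \<in> B" using max by blast
    then show False using out power_products_base by blast
  qed
  then show ?thesis using that B by blast
qed

text \<open>
  Raising a relation between the roots to the \<open>p\<close>-th power gives a relation between the \<open>c\<close>.
  Hence all \<open>c ^ n\<close> in it are \<open>1\<close>, the factors of the original relation are powers of the \<open>c\<close>
  as well, and a second use of the independence of \<open>C\<close> finishes the proof.
\<close>

lemma lift_basis:
  assumes p: "prime p" and C: "independent C"
    and ordC: "\<forall>c\<in>C. \<exists>q k. prime q \<and> k > 0 \<and> has_order c (q ^ k)"
    and T: "1 \<in> T" "\<forall>x\<in>T. \<forall>y\<in>T. x * y \<in> T"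
    and CT: "C \<subseteq> (\<lambda>x. x ^ p) ` T"
  shows "\<exists>r. (\<forall>c\<in>C. r c \<in> T \<and> r c ^ p = c \<and> (\<exists>q k. prime q \<and> k > 0 \<and> has_order (r c) (q ^ k))) \<and>
    independent (r ` C)"
proof -
  have powT: "x ^ n \<in> T" if "x \<in> T" for x n by (induction n) (use T that in auto)
  have "\<exists>b d. b \<in> T \<and> b ^ p = c \<and> (\<exists>q k. prime q \<and> k > 0 \<and> has_order b (q ^ k)) \<and>
    (\<forall>n. c ^ n = 1 \<longrightarrow> b ^ n = c ^ (if d then n div p else 0))" if c: "c \<in> C" for c
  proof -
    obtain x where x: "x \<in> T" "x ^ p = c" using CT c by blast
    obtain q k where qk: "prime q" "k > 0" "has_order c (q ^ k)" using ordC c by blast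
    have cT: "c \<in> T" using x powT by blast
    obtain b s where b: "b = x \<or> b = c ^ s" "b ^ p = c"
      "\<exists>q k. prime q \<and> k > 0 \<and> has_order b (q ^ k)"
      "\<And>n. c ^ n = 1 \<Longrightarrow> b ^ n = c ^ (if p dvd q ^ k then n div p else 0)"
      by (rule root_of_prime_power_order[OF p qk(3) refl qk(1,2) x(2)]) blast
    have "b \<in> T" using b(1) x(1) powT[OF cT] by blast
    then show ?thesis
      using b(2-4) by (intro exI[of _ b] exI[of _ "p dvd q ^ k"]) simp
  qed
  then obtain r d where r: "\<And>c. c \<in> C \<Longrightarrow> r c \<in> T" "\<And>c. c \<in> C \<Longrightarrow> r c ^ p = c"
    "\<And>c. c \<in> C \<Longrightarrow> \<exists>q k. prime q \<and> k > 0 \<and> has_order (r c) (q ^ k)"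
    "\<And>c n. c \<in> C \<Longrightarrow> c ^ n = 1 \<Longrightarrow> r c ^ n = c ^ (if d c then n div p else 0)"
    by metis
  have inj: "inj_on r F" if "F \<subseteq> C" for F by (rule inj_onI) (metis r(2) that subsetD)
  have "independent (r ` C)"
    unfolding independent_def
  proof (intro allI impI)
    fix F n assume F: "finite F" "F \<subseteq> r ` C" "(\<Prod>b\<in>F. b ^ n b) = 1"
    obtain G where G: "finite G" "G \<subseteq> C" "F = r ` G" using F finite_subset_image by metis
    define k where "k c = n (r c)" for c
    define l where "l c = (if d c then k c div p else 0)" for c
    have one: "(\<Prod>c\<in>G. r c ^ k c) = 1"
      using F(3) prod.reindex[OF inj[OF G(2)], of "\<lambda>b. b ^ n b"] unfolding G(3) k_def by simp
    have "(\<Prod>c\<in>G. c ^ k c) = (\<Prod>c\<in>G. r c ^ k c) ^ p"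
      unfolding prod_power by (rule prod.cong) (use G r(2) in \<open>auto simp: power_swap[of _ _ p]\<close>)
    then have "(\<Prod>c\<in>G. c ^ k c) = 1" unfolding one by simp
    then have "c ^ k c = 1" if "c \<in> G" for c using independentD[OF C G(1,2) _ that] by blast
    then have eq: "r c ^ k c = c ^ l c" if "c \<in> G" for c
      using r(4) that G unfolding l_def by blast
    then have "(\<Prod>c\<in>G. c ^ l c) = 1" using one by simp
    then have "c ^ l c = 1" if "c \<in> G" for c using independentD[OF C G(1,2) _ that] by blast
    then show "\<forall>b\<in>F. b ^ n b = 1" using eq unfolding G(3) k_def by auto
  qed
  then show ?thesis using r(1-3) by (intro exI[of _ r]) simp
qed

text \<open>
  The theorem of Pruefer and Baer, by induction on the exponent.  For a prime \<open>p\<close> dividing \<open>N\<close>, the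
  group of \<open>p\<close>-th powers has exponent \<open>N / p\<close> and thus a basis.  The \<open>p\<close>-th roots of this basis are
  independent and generate \<open>T\<close> up to elements of order \<open>p\<close>, which are then added.  The
  orders are kept prime powers, as the choice of roots depends on it.
\<close>

theorem bounded_group_has_basis:
  assumes "N > 0" "1 \<in> T" "\<forall>x\<in>T. \<forall>y\<in>T. x * y \<in> T" "\<forall>x\<in>T. x ^ N = 1"
  shows "\<exists>B. independent B \<and> power_products B = T \<and>
    (\<forall>b\<in>B. \<exists>q k. prime q \<and> k > 0 \<and> has_order b (q ^ k))"
  using assms
proof (induction N arbitrary: T rule: less_induct)
  case (less N T)
  note T = less.prems(2-4)
  show ?case
  proof (cases "N = 1")
    case True
    have "x = 1" if "x \<in> T" for x using bspec[OF T(3) that] unfolding True by simp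
    then have "T = {1}" using T(1) by blast
    moreover have "power_products {} = {1}" unfolding power_products_def by simp
    ultimately show ?thesis by (intro exI[of _ "{}"]) (simp add: independent_def)
  next
    case False
    then obtain p where p: "prime p" "p dvd N" using prime_factor_nat[of N] by auto
    from p(2) obtain N' where N': "N = p * N'" .. 
    have p1: "p > 1" using p(1) prime_gt_1_nat by blast
    let ?T' = "(\<lambda>x. x ^ p) ` T"
    have "\<exists>C. independent C \<and> power_products C = ?T' \<and>
      (\<forall>b\<in>C. \<exists>q k. prime q \<and> k > 0 \<and> has_order b (q ^ k))"
    proof (rule less.IH)
      show "N' < N" "0 < N'" using N' less.prems(1) p1 by auto
      show "1 \<in> ?T'" using T(1) by (force intro: rev_image_eqI)
      show "\<forall>x\<in>?T'. \<forall>y\<in>?T'. x * y \<in> ?T'"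
        using T(2) by (auto simp flip: power_mult_distrib)
      show "\<forall>x\<in>?T'. x ^ N' = 1"
        using T(3) unfolding N' power_mult by blast
    qed
    then obtain C where C: "independent C" "power_products C = ?T'"
      "\<forall>b\<in>C. \<exists>q k. prime q \<and> k > 0 \<and> has_order b (q ^ k)"
      by (elim exE conjE)
    have CT: "C \<subseteq> ?T'" using C(2) power_products_base by blast
    obtain r where r: "\<And>c. c \<in> C \<Longrightarrow> r c \<in> T \<and> r c ^ p = c" "independent (r ` C)"
      "\<And>c. c \<in> C \<Longrightarrow> \<exists>q k. prime q \<and> k > 0 \<and> has_order (r c) (q ^ k)"
      using lift_basis[OF p(1) C(1,3) T(1,2) CT] by (elim exE conjE) metis
    have rT: "r ` C \<subseteq> T" using r(1) by blast
    obtain B where B: "r ` C \<subseteq> B" "B \<subseteq> r ` C \<union> {x \<in> T. has_order x p}" "independent B"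
      "{x \<in> T. x ^ p = 1} \<subseteq> power_products B"
      using extend_independent[OF r(2) rT p(1) less.prems] .
    have "B \<subseteq> T" using B(2) rT by blast
    then have BT: "power_products B \<subseteq> T" using power_products_subset T by blast
    have "T \<subseteq> power_products B"
    proof
      fix x assume x: "x \<in> T"
      then have "x ^ p \<in> power_products C" using C(2) by blast
      then obtain F n where F: "finite F" "F \<subseteq> C" "x ^ p = (\<Prod>c\<in>F. c ^ n c)"
        unfolding power_products_def by blast
      define y where "y = (\<Prod>c\<in>F. r c ^ n c)"
      have "(\<Prod>c\<in>F. r c ^ n c) \<in> power_products B"
        using F(1,2)
      proof (induction F rule: finite_induct)
        case (insert c F)
        then have "r c \<in> B" using B(1) by blast
        then show ?case
          using insert by (simp add: power_products_mult power_products_power power_products_base)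
      qed (simp add: power_products_one)
      then have y: "y \<in> power_products B" unfolding y_def .
      have yp: "y ^ p = x ^ p"
        unfolding y_def prod_power F(3)
        by (rule prod.cong) (use F r(1) in \<open>auto simp: power_swap[of _ _ p]\<close>)
      have yN: "y ^ N = 1" using y BT T(3) by blast
      \<comment> \<open>\<open>z\<close> is the quotient of \<open>x\<close> and \<open>y\<close>, which have the same \<open>p\<close>-th power.\<close>
      define z where "z = x * y ^ (N - 1)"
      have "y ^ (N - 1) \<in> power_products B" using y by (rule power_products_power)
      then have zT: "z \<in> T" using x T(2) BT unfolding z_def by blast
      have "z ^ p = (y * y ^ (N - 1)) ^ p" unfolding z_def power_mult_distrib yp ..
      also have "y * y ^ (N - 1) = 1"
        using yN less.prems(1) power_minus_mult[of N y] by (simp add: ac_simps)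
      finally have "z ^ p = 1" by simp
      then have z: "z \<in> power_products B" using zT B(4) by blast
      have "z * y = x * (y ^ (N - 1) * y)" unfolding z_def by (simp only: mult.assoc)
      also have "\<dots> = x" using yN less.prems(1) power_minus_mult[of N y] by simp
      finally show "x \<in> power_products B" using power_products_mult[OF z y] by simp
    qed
    moreover have "\<exists>q k. prime q \<and> k > 0 \<and> has_order b (q ^ k)" if "b \<in> B" for b
    proof (cases "b \<in> r ` C")
      case False
      then have "has_order b (p ^ 1)" using that B(2) by auto
      then show ?thesis using p(1) zero_less_one by blast
    qed (use r(3) in blast)
    ultimately show ?thesis using B(3) BT by blast
  qed
qed

end

section \<open>Counting isomorphism types\<close>

text \<open>
  The principle behind all upper bounds.  The data \<open>k\<close> may depend on choices, such as an enumeration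
  or a basis, and differ between isomorphic subdirect powers.
\<close>

lemma iso_types_lepoll:
  fixes k :: "'i set \<times> ('i \<Rightarrow> 'a) set \<Rightarrow> 'k"
  assumes "\<And>X T Y U. (X, T) \<in> countable_subdirect_powers m \<Longrightarrow> (Y, U) \<in> countable_subdirect_powers m \<Longrightarrow>
    k (X, T) = k (Y, U) \<Longrightarrow> semigroup_isomorphic T (power_mult m X) U (power_mult m Y)"
  shows "(subdirect_power_iso_types m :: ('i set \<times> ('i \<Rightarrow> 'a) set) set set) \<lesssim> k ` countable_subdirect_powers m"
proof -
  let ?r = "power_iso_rel m :: (('i set \<times> ('i \<Rightarrow> 'a) set) \<times> ('i set \<times> ('i \<Rightarrow> 'a) set)) set"
  let ?A = "countable_subdirect_powers m :: ('i set \<times> ('i \<Rightarrow> 'a) set) set"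
  have eq: "equiv ?A ?r" by (rule equiv_power_iso_rel)
  have rep: "(SOME P. P \<in> c) \<in> c" if "c \<in> ?A // ?r" for c
    using in_quotient_imp_non_empty[OF eq that] by (simp add: some_in_eq)
  have sub: "c \<subseteq> ?A" if "c \<in> ?A // ?r" for c
    using in_quotient_imp_subset[OF eq that] .
  have inj: "inj_on (\<lambda>c. k (SOME P. P \<in> c)) (?A // ?r)"
  proof (rule inj_onI)
    fix c c' assume c: "c \<in> ?A // ?r" "c' \<in> ?A // ?r" "k (SOME P. P \<in> c) = k (SOME P. P \<in> c')"
    obtain X T Y U where PQ: "(SOME P. P \<in> c) = (X, T)" "(SOME P. P \<in> c') = (Y, U)" by fastforce
    have mem: "(X, T) \<in> c" "(Y, U) \<in> c'" using rep c PQ by metis+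
    then have "((X, T), (Y, U)) \<in> ?r"
      using assms[of X T Y U] sub c PQ unfolding power_iso_rel_def by auto
    then show "c = c'" using quotient_eq_iff[OF eq c(1,2) mem] by simp
  qed
  have im: "(\<lambda>c. k (SOME P. P \<in> c)) ` (?A // ?r) \<subseteq> k ` ?A"
    using rep sub by blast
  show ?thesis
    unfolding subdirect_power_iso_types_def lepoll_def
    by (intro exI[of _ "\<lambda>c. k (SOME P. P \<in> c)"] conjI inj im)
qed

text \<open>
  The multiplication table of a countable subdirect power, written down along an enumeration of its
  elements and coded as a set of natural numbers, determines the isomorphism type.
\<close>

lemma iso_types_lepoll_continuum:
  "(subdirect_power_iso_types m :: ('i set \<times> ('i \<Rightarrow> 'a) set) set set) \<lesssim> (UNIV :: (nat \<Rightarrow> bool) set)"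
proof -
  define k :: "'i set \<times> ('i \<Rightarrow> 'a) set \<Rightarrow> (nat \<Rightarrow> bool)" where
    "k = (\<lambda>(X, T) n. \<exists>a\<in>T. \<exists>b\<in>T. n = prod_encode (to_nat_on T a,
      prod_encode (to_nat_on T b, to_nat_on T (power_mult m X a b))))"
  have "(subdirect_power_iso_types m :: ('i set \<times> ('i \<Rightarrow> 'a) set) set set) \<lesssim> k ` countable_subdirect_powers m"
  proof (rule iso_types_lepoll)
    fix X Y :: "'i set" and T U :: "('i \<Rightarrow> 'a) set"
    assume "(X, T) \<in> countable_subdirect_powers m" "(Y, U) \<in> countable_subdirect_powers m"
      and eq: "k (X, T) = k (Y, U)"
    then have T: "countable T" "\<And>a b. a \<in> T \<Longrightarrow> b \<in> T \<Longrightarrow> power_mult m X a b \<in> T"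
      and U: "countable U" "\<And>a b. a \<in> U \<Longrightarrow> b \<in> U \<Longrightarrow> power_mult m Y a b \<in> U"
      unfolding countable_subdirect_powers_def subdirect_power_def by auto
    define t where "t = to_nat_on T"
    define u where "u = to_nat_on U"
    have inj: "inj_on t T" "inj_on u U" unfolding t_def u_def using T U by (auto intro: inj_on_to_nat_on)
    have 1: "\<exists>a'\<in>U. \<exists>b'\<in>U. t a = u a' \<and> t b = u b' \<and> t (power_mult m X a b) = u (power_mult m Y a' b')"
      if "a \<in> T" "b \<in> T" for a b
    proof -
      have "k (X, T) (prod_encode (t a, prod_encode (t b, t (power_mult m X a b))))"
        unfolding k_def t_def using that by auto
      then show ?thesis unfolding eq unfolding k_def u_def by (auto simp: prod_encode_eq)
    qed
    have 2: "\<exists>a'\<in>T. u a = t a'" if "a \<in> U" for a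
    proof -
      have "k (Y, U) (prod_encode (u a, prod_encode (u a, u (power_mult m Y a a))))"
        unfolding k_def u_def using that by auto
      then show ?thesis unfolding eq[symmetric] unfolding k_def t_def by (auto simp: prod_encode_eq)
    qed
    have im: "t ` T = u ` U" using 1 2 by (auto simp: image_iff) blast+
    define h where "h = inv_into U u \<circ> t"
    have "bij_betw h T U"
      unfolding h_def
      by (rule bij_betw_trans[of _ _ "t ` T"]) (use inj im in \<open>auto simp: bij_betw_def inj_on_inv_into\<close>)
    moreover have hu: "h a = a'" if "t a = u a'" "a' \<in> U" for a a'
      unfolding h_def using that inj by simp
    have "h (power_mult m X a b) = power_mult m Y (h a) (h b)" if ab: "a \<in> T" "b \<in> T" for a b
    proof -
      obtain a' b' where *: "a' \<in> U" "b' \<in> U" "t a = u a'" "t b = u b'"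
        "t (power_mult m X a b) = u (power_mult m Y a' b')" using 1[OF ab] by blast
      then show ?thesis using hu U(2) by simp
    qed
    ultimately show "semigroup_isomorphic T (power_mult m X) U (power_mult m Y)"
      unfolding semigroup_isomorphic_def by blast
  qed
  then show ?thesis using lepoll_trans subset_imp_lepoll subset_UNIV by blast
qed

text \<open>
  A code for the cardinality of a countable set; \<open>card\<close> alone does not separate the infinite
  sets from the empty one.
\<close>

definition countable_size :: "'b set \<Rightarrow> bool \<times> nat"
  where "countable_size A = (finite A, card A)"

lemma bij_betw_if_same_size:
  assumes "countable A" "countable B" "countable_size A = countable_size B"
  shows "\<exists>s. bij_betw s A B"
proof (cases "finite A")
  case True
  then show ?thesis using assms(3) finite_same_card_bij unfolding countable_size_def by auto
next
  case False
  then show ?thesis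
    using assms bij_betw_trans bij_betw_inv_into to_nat_on_infinite
    unfolding countable_size_def by (metis prod.inject)
qed

section \<open>Null semigroups\<close>

text \<open>
  A null semigroup is a set with a distinguished element, so its cardinality determines it.
\<close>

lemma countable_iso_types_null:
  assumes "null_semigroup m"
  shows "countable (subdirect_power_iso_types m :: ('i set \<times> ('i \<Rightarrow> 'a) set) set set)"
proof -
  obtain z where z: "\<And>s t. m s t = z" using assms unfolding null_semigroup_def by blast
  let ?A = "countable_subdirect_powers m :: ('i set \<times> ('i \<Rightarrow> 'a) set) set"
  have "(subdirect_power_iso_types m :: ('i set \<times> ('i \<Rightarrow> 'a) set) set set) \<lesssim> (\<lambda>(X, T). countable_size T) ` ?A"
  proof (rule iso_types_lepoll)
    fix X Y :: "'i set" and T U :: "('i \<Rightarrow> 'a) set"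
    assume "(X, T) \<in> ?A" "(Y, U) \<in> ?A"
      and "(case (X, T) of (X, T) \<Rightarrow> countable_size T) = (case (Y, U) of (X, T) \<Rightarrow> countable_size T)"
    then have T: "countable T" "T \<noteq> {}" "\<And>a b. a \<in> T \<Longrightarrow> b \<in> T \<Longrightarrow> power_mult m X a b \<in> T"
      and U: "countable U" "U \<noteq> {}" "\<And>a b. a \<in> U \<Longrightarrow> b \<in> U \<Longrightarrow> power_mult m Y a b \<in> U"
      and eq: "countable_size T = countable_size U"
      unfolding countable_subdirect_powers_def subdirect_power_def by auto
    define t where "t = (\<lambda>x\<in>X. z)"
    define u where "u = (\<lambda>x\<in>Y. z)"
    have mult: "power_mult m X a b = t" "power_mult m Y a b = u" for a b
      unfolding power_mult_def t_def u_def z by auto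
    have tT: "t \<in> T" "u \<in> U" using T U unfolding mult by blast+
    have "countable_size (T - {t}) = countable_size (U - {u})"
      using eq tT unfolding countable_size_def by (auto simp: card_Diff_singleton)
    then obtain s where s: "bij_betw s (T - {t}) (U - {u})"
      using bij_betw_if_same_size[of "T - {t}" "U - {u}"] T(1) U(1) by auto
    define h where "h = s(t := u)"
    have "bij_betw h (T - {t}) (U - {u})"
      using s by (rule bij_betw_cong[THEN iffD1, rotated]) (simp add: h_def)
    then have "bij_betw h ((T - {t}) \<union> {t}) ((U - {u}) \<union> {h t})"
      by (subst notIn_Un_bij_betw3[symmetric]) (simp_all add: h_def)
    then have "bij_betw h T U" using tT by (simp add: h_def insert_absorb)
    moreover have "h t = u" unfolding h_def by simp
    ultimately show "semigroup_isomorphic T (power_mult m X) U (power_mult m Y)"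
      unfolding semigroup_isomorphic_def mult by blast
  qed
  then show ?thesis using countable_lepoll by (metis countableI_type)
qed

section \<open>Abelian groups\<close>

context comm_monoid_mult
begin

text \<open>
  Only finitely many orders occur, so the isomorphism type is determined by a finite list of
  countable cardinalities.
\<close>

lemma isomorphic_if_same_order_counts:
  assumes "N > 0"
    and B: "independent B" "countable B" "\<forall>b\<in>B. \<exists>d\<le>N. has_order b d"
    and C: "independent C" "countable C" "\<forall>b\<in>C. \<exists>d\<le>N. has_order b d"
    and eq: "\<And>d. d \<le> N \<Longrightarrow> countable_size {b \<in> B. has_order b d} = countable_size {b \<in> C. has_order b d}"
    and ex: "\<forall>b\<in>B. b ^ N = 1"
  shows "semigroup_isomorphic (power_products B) (*) (power_products C) (*)"
proof -
  have "\<exists>s. bij_betw s {b \<in> B. has_order b d} {b \<in> C. has_order b d}" if "d \<le> N" for d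
    using bij_betw_if_same_size[OF _ _ eq[OF that]] B(2) C(2) by simp
  then obtain s where s: "\<And>d. d \<le> N \<Longrightarrow> bij_betw (s d) {b \<in> B. has_order b d} {b \<in> C. has_order b d}"
    by metis
  obtain o' where o': "\<And>b. b \<in> B \<Longrightarrow> o' b \<le> N \<and> has_order b (o' b)" using B(3) by metis
  define h where "h b = s (o' b) b" for b
  have h: "h b \<in> C \<and> has_order (h b) (o' b)" if "b \<in> B" for b
    using s[of "o' b"] o'[OF that] that unfolding h_def by (auto dest!: bij_betwE)
  have "bij_betw h B C"
    unfolding bij_betw_def
  proof (intro conjI inj_onI equalityI subsetI)
    fix a b assume ab: "a \<in> B" "b \<in> B" "h a = h b"
    then have od: "o' a = o' b" using h has_order_unique by metis
    have "inj_on (s (o' b)) {c \<in> B. has_order c (o' b)}"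
      using bij_betw_imp_inj_on[OF s] o'[OF ab(2)] by blast
    then show "a = b"
      by (rule inj_onD) (use ab od o'[OF ab(1)] o'[OF ab(2)] in \<open>auto simp: h_def\<close>)
  next
    fix c assume c: "c \<in> C"
    then obtain d where d: "d \<le> N" "has_order c d" using C(3) by blast
    then have "c \<in> s d ` {b \<in> B. has_order b d}"
      unfolding bij_betw_imp_surj_on[OF s[OF d(1)]] using c by simp
    then obtain b where b: "b \<in> B" "has_order b d" "s d b = c" by blast
    then have "o' b = d" using o' has_order_unique by blast
    then show "c \<in> h ` B" using b unfolding h_def by blast
  qed (use h in auto)
  moreover have "h b ^ n = 1 \<longleftrightarrow> b ^ n = 1" if "b \<in> B" for b n
    using has_orderD[of "h b" "o' b" n] has_orderD[of b "o' b" n] h[OF that] o'[OF that] by simp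
  ultimately show ?thesis
    using ex by (intro isomorphic_of_bases[where s = h, OF B(1) C(1) assms(1)]) simp_all
qed

lemma finite_group_exponent:
  assumes fin: "finite (UNIV :: 'a set)" and inv: "\<And>x. \<exists>y. y * x = 1"
  shows "\<exists>N>0. \<forall>x. x ^ N = 1"
proof -
  have "\<exists>k>0. x ^ k = 1" for x
  proof -
    have "\<not> inj (\<lambda>n :: nat. x ^ n)"
      using fin finite_imageD[of "\<lambda>n. x ^ n" UNIV] by (metis finite_subset subset_UNIV infinite_UNIV_nat)
    then obtain i j where "x ^ i = x ^ j" "i \<noteq> j" unfolding inj_def by blast
    then obtain i j where ij: "x ^ i = x ^ j" "i < j" by (metis nat_neq_iff)
    obtain y where y: "y * x = 1" using inv by blast
    have yi: "y ^ i * x ^ i = 1" unfolding power_mult_distrib[symmetric] y by simp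
    have "x ^ j = x ^ i * x ^ (j - i)" using ij(2) by (simp flip: power_add)
    then have "y ^ i * x ^ i = (y ^ i * x ^ i) * x ^ (j - i)" using ij(1) by (simp add: mult.assoc)
    then have "x ^ (j - i) = 1" unfolding yi by simp
    then show ?thesis using ij(2) zero_less_diff by blast
  qed
  then obtain k where k: "\<And>x. k x > (0::nat)" "\<And>x. x ^ k x = 1" by metis
  have "x ^ prod k UNIV = 1" for x
  proof -
    have "k x dvd prod k UNIV" using fin by (simp add: dvd_prodI)
    then obtain l where "prod k UNIV = k x * l" ..
    then show ?thesis using k(2) by (simp add: power_mult)
  qed
  moreover have "prod k UNIV > 0" using k(1) by (simp add: prod_pos)
  ultimately show ?thesis by blast
qed

end

text \<open>
  Functions on \<open>X\<close> are extended by the neutral element to the whole index type, so that all subdirect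
  powers become submonoids of one and the same commutative monoid.
\<close>

lemma countable_iso_types_group:
  fixes m :: "'a \<Rightarrow> 'a \<Rightarrow> 'a"
  assumes fin: "finite (UNIV :: 'a set)" and ab: "is_abelian_group m"
  shows "countable (subdirect_power_iso_types m :: ('i set \<times> ('i \<Rightarrow> 'a) set) set set)"
proof -
  obtain e i where grp: "group m e i" and abel: "abel_semigroup m"
    using ab unfolding is_abelian_group_def by blast
  interpret ab: abel_semigroup m by (rule abel)
  interpret gp: group m e i by (rule grp)
  interpret S: comm_monoid_mult m e
    by unfold_locales (simp_all add: ab.assoc ab.commute ab.left_commute gp.group_left_neutral)
  let ?m = "\<lambda>(f :: 'i \<Rightarrow> 'a) g x. m (f x) (g x)"
  let ?e = "\<lambda>_ :: 'i. e"
  interpret P: comm_monoid_mult ?m ?e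
    by unfold_locales (simp_all add: ab.assoc ab.commute ab.left_commute fun_eq_iff)
  obtain N where N: "N > 0" "\<And>x. power.power e m x N = e"
    using S.finite_group_exponent[OF fin] gp.left_inverse by metis
  have pow: "power.power ?e ?m f n = (\<lambda>x. power.power e m (f x) n)" for f n
    by (induction n) (simp_all add: power.power.simps)
  have exP: "power.power ?e ?m f N = ?e" for f unfolding pow N(2) ..
  define ext where "ext X f = (\<lambda>x. if x \<in> X then f x else e)" for X and f :: "'i \<Rightarrow> 'a"
  let ?A = "countable_subdirect_powers m :: ('i set \<times> ('i \<Rightarrow> 'a) set) set"
  have ext: "semigroup_isomorphic T (power_mult m X) (ext X ` T) ?m \<and>
      (\<exists>B. P.independent B \<and> P.power_products B = ext X ` T \<and> countable B \<and>
        (\<forall>b\<in>B. \<exists>d\<le>N. P.has_order b d))"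
    if "(X, T) \<in> ?A" for X T
  proof -
    have T: "countable T" "T \<noteq> {}" "T \<subseteq> X \<rightarrow>\<^sub>E UNIV"
      "\<And>a b. a \<in> T \<Longrightarrow> b \<in> T \<Longrightarrow> power_mult m X a b \<in> T"
      using that unfolding countable_subdirect_powers_def subdirect_power_def direct_power_def by auto
    have hom: "ext X (power_mult m X a b) = ?m (ext X a) (ext X b)" for a b
      unfolding ext_def power_mult_def by auto
    have "inj_on (ext X) T"
    proof (rule inj_onI)
      fix f g assume fg: "f \<in> T" "g \<in> T" "ext X f = ext X g"
      show "f = g"
      proof (rule PiE_ext)
        show "f \<in> X \<rightarrow>\<^sub>E UNIV" "g \<in> X \<rightarrow>\<^sub>E UNIV" using T(3) fg by auto
        show "f x = g x" if "x \<in> X" for x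
          using fun_cong[OF fg(3), of x] that unfolding ext_def by simp
      qed
    qed
    then have iso: "semigroup_isomorphic T (power_mult m X) (ext X ` T) ?m"
      unfolding semigroup_isomorphic_def using hom by (intro exI[of _ "ext X"]) (auto simp: bij_betw_def)
    have closed: "\<forall>x\<in>ext X ` T. \<forall>y\<in>ext X ` T. ?m x y \<in> ext X ` T"
      using T(4) by (auto simp flip: hom)
    have pcl: "x \<in> ext X ` T \<Longrightarrow> power.power ?e ?m x (Suc n) \<in> ext X ` T" for x n
    proof (induction n)
      case (Suc n)
      then show ?case using closed by (simp only: power.power.simps)
    qed (simp add: power.power.simps)
    obtain t where "t \<in> T" using T(2) by blast
    then have one: "?e \<in> ext X ` T" using pcl[of "ext X t" "N - 1"] N(1) exP[of "ext X t"] by simp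
    have exT: "\<forall>x\<in>ext X ` T. power.power ?e ?m x N = ?e" using exP by blast
    obtain B where B: "P.independent B" "P.power_products B = ext X ` T"
      "\<forall>b\<in>B. \<exists>q k. prime q \<and> k > 0 \<and> P.has_order b (q ^ k)"
      using P.bounded_group_has_basis[OF N(1) one closed exT] by (elim exE conjE)
    have "B \<subseteq> ext X ` T" unfolding B(2)[symmetric] by (rule subsetI) (rule P.power_products_base)
    then have "countable B" by (rule countable_subset) (rule countable_image[OF T(1)])
    moreover have "\<exists>d\<le>N. P.has_order b d" if b: "b \<in> B" for b
    proof -
      obtain d where d: "P.has_order b d" using bspec[OF B(3) b] by (elim exE conjE)
      have "d dvd N" using exP[of b] P.has_orderD[OF d] by simp
      then show ?thesis using d N(1) dvd_imp_le by blast
    qed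
    ultimately show ?thesis using iso B(1,2) by (intro conjI exI[of _ B]) auto
  qed
  define bas where "bas X T = (SOME B. P.independent B \<and> P.power_products B = ext X ` T \<and>
    countable B \<and> (\<forall>b\<in>B. \<exists>d\<le>N. P.has_order b d))" for X and T :: "('i \<Rightarrow> 'a) set"
  have bas: "P.independent (bas X T) \<and> P.power_products (bas X T) = ext X ` T \<and>
      countable (bas X T) \<and> (\<forall>b\<in>bas X T. \<exists>d\<le>N. P.has_order b d)" if "(X, T) \<in> ?A" for X T
    unfolding bas_def by (rule someI_ex) (use ext[OF that] in simp)
  define k where "k = (\<lambda>(X, T). map (\<lambda>d. countable_size {b \<in> bas X T. P.has_order b d}) [0..<Suc N])"
  have "(subdirect_power_iso_types m :: ('i set \<times> ('i \<Rightarrow> 'a) set) set set) \<lesssim> k ` ?A"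
  proof (rule iso_types_lepoll)
    fix X Y :: "'i set" and T U :: "('i \<Rightarrow> 'a) set"
    assume XT: "(X, T) \<in> ?A" and YU: "(Y, U) \<in> ?A" and eq: "k (X, T) = k (Y, U)"
    have eq': "countable_size {b \<in> bas X T. P.has_order b d} = countable_size {b \<in> bas Y U. P.has_order b d}"
      if "d \<le> N" for d
      using eq that unfolding k_def by (simp del: upt_Suc)
    have "semigroup_isomorphic (P.power_products (bas X T)) ?m (P.power_products (bas Y U)) ?m"
    proof (rule P.isomorphic_if_same_order_counts[OF N(1)])
      show "P.independent (bas X T)" "countable (bas X T)" "\<forall>b\<in>bas X T. \<exists>d\<le>N. P.has_order b d"
        by (insert bas[OF XT]) (elim conjE, assumption)+
      show "P.independent (bas Y U)" "countable (bas Y U)" "\<forall>b\<in>bas Y U. \<exists>d\<le>N. P.has_order b d"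
        by (insert bas[OF YU]) (elim conjE, assumption)+
    qed (rule eq', assumption, intro ballI exP)
    then have mid: "semigroup_isomorphic (ext X ` T) ?m (ext Y ` U) ?m"
      using bas[OF XT] bas[OF YU] by simp
    have "semigroup_isomorphic (ext Y ` U) ?m U (power_mult m Y)"
      by (rule semigroup_isomorphic_sym) (use ext[OF YU] YU in
        \<open>auto simp: countable_subdirect_powers_def subdirect_power_def\<close>)
    then show "semigroup_isomorphic T (power_mult m X) U (power_mult m Y)"
      by (rule semigroup_isomorphic_trans[OF conjunct1[OF ext[OF XT]] semigroup_isomorphic_trans[OF mid]])
  qed
  then show ?thesis using countable_lepoll countableI_type by blast
qed

section \<open>Continuum many isomorphism types from an invariant\<close>

text \<open>
  Countable subdirect powers over any one index type, here the whole type \<open>'j\<close>, are isomorphic to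
  ones over \<open>'i\<close>, so the two constructions below may use their own index types.
\<close>

lemma continuum_lepoll_iso_types:
  fixes T :: "nat set \<Rightarrow> ('j \<Rightarrow> 'a) set"
  assumes inf: "infinite (UNIV :: 'i set)"
    and T: "\<And>M. subdirect_power m UNIV (T M)" "\<And>M. countable (T M)"
    and noniso: "\<And>M M'. semigroup_isomorphic (T M) (power_mult m UNIV) (T M') (power_mult m UNIV) \<Longrightarrow>
      M = M'"
  shows "(UNIV :: (nat \<Rightarrow> bool) set) \<lesssim> (subdirect_power_iso_types m :: ('i set \<times> ('i \<Rightarrow> 'a) set) set set)"
proof -
  have "\<exists>P :: 'i set \<times> ('i \<Rightarrow> 'a) set. P \<in> countable_subdirect_powers m \<and>
      semigroup_isomorphic (T M) (power_mult m UNIV) (snd P) (power_mult m (fst P))" for M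
    using countable_subdirect_power_any_index_type[OF inf T(1)[of M] T(2)[of M]]
    unfolding countable_subdirect_powers_def by fastforce
  then obtain P :: "nat set \<Rightarrow> 'i set \<times> ('i \<Rightarrow> 'a) set"
    where P: "\<And>M. P M \<in> countable_subdirect_powers m"
      "\<And>M. semigroup_isomorphic (T M) (power_mult m UNIV) (snd (P M)) (power_mult m (fst (P M)))"
    by metis
  have inj: "inj (\<lambda>b :: nat \<Rightarrow> bool. power_iso_rel m `` {P (Collect b)})"
  proof (rule injI)
    fix b b' assume "power_iso_rel m `` {P (Collect b)} = power_iso_rel m `` {P (Collect b')}"
    then have "(P (Collect b), P (Collect b')) \<in> power_iso_rel m"
      using eq_equiv_class_iff[OF equiv_power_iso_rel P(1) P(1)] by blast
    then have mid: "semigroup_isomorphic (snd (P (Collect b))) (power_mult m (fst (P (Collect b))))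
        (snd (P (Collect b'))) (power_mult m (fst (P (Collect b'))))"
      unfolding power_iso_rel_def by (auto split: prod.splits)
    have up: "semigroup_isomorphic (snd (P (Collect b'))) (power_mult m (fst (P (Collect b'))))
        (T (Collect b')) (power_mult m UNIV)"
      using P(2) by (rule semigroup_isomorphic_sym) (use T(1) in \<open>auto simp: subdirect_power_def\<close>)
    have "Collect b = Collect b'"
      by (rule noniso[OF semigroup_isomorphic_trans[OF P(2) semigroup_isomorphic_trans[OF mid up]]])
    then show "b = b'" by (simp add: Collect_inj)
  qed
  have "power_iso_rel m `` {P M} \<in> subdirect_power_iso_types m" for M
    unfolding subdirect_power_iso_types_def using P(1) by (rule quotientI)
  then show ?thesis unfolding lepoll_def using inj
    by (intro exI[of _ "\<lambda>b. power_iso_rel m `` {P (Collect b)}"]) auto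
qed

text \<open>
  Both isomorphism invariants have this form, for a relation that is definable from the
  multiplication.  Infinite sets are left out because their \<open>card\<close> would be \<open>0\<close>.
\<close>

definition related_set_sizes :: "'b set \<Rightarrow> ('b \<Rightarrow> 'b \<Rightarrow> bool) \<Rightarrow> nat set"
  where "related_set_sizes A R = {card {y \<in> A. R x y} | x. x \<in> A \<and> finite {y \<in> A. R x y}}"

lemma related_set_sizes_cong:
  assumes h: "bij_betw h A B" and R: "\<And>x y. x \<in> A \<Longrightarrow> y \<in> A \<Longrightarrow> R x y \<longleftrightarrow> Q (h x) (h y)"
  shows "related_set_sizes A R = related_set_sizes B Q"
proof -
  have im: "{y \<in> B. Q (h x) y} = h ` {y \<in> A. R x y}" if "x \<in> A" for x
    using R[OF that] h by (auto simp: bij_betw_def)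
  have inj: "inj_on h {y \<in> A. R x y}" for x
    using h by (auto simp: bij_betw_def inj_on_def)
  have size: "card {y \<in> B. Q (h x) y} = card {y \<in> A. R x y}"
    "finite {y \<in> B. Q (h x) y} = finite {y \<in> A. R x y}" if "x \<in> A" for x
    unfolding im[OF that] using inj by (simp_all add: card_image finite_image_iff)
  have "related_set_sizes B Q =
      {card {y \<in> B. Q (h x) y} | x. x \<in> A \<and> finite {y \<in> B. Q (h x) y}}"
    using h unfolding related_set_sizes_def by (auto simp: bij_betw_def)
  also have "\<dots> = related_set_sizes A R"
    unfolding related_set_sizes_def using size by (metis (lifting))
  finally show ?thesis ..
qed

definition translation_equal :: "'b set \<Rightarrow> ('b \<Rightarrow> 'b \<Rightarrow> 'b) \<Rightarrow> 'b \<Rightarrow> 'b \<Rightarrow> bool"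
  where "translation_equal A f x y \<longleftrightarrow> (\<forall>z\<in>A. f x z = f y z)"

definition idempotent_below :: "('b \<Rightarrow> 'b \<Rightarrow> 'b) \<Rightarrow> 'b \<Rightarrow> 'b \<Rightarrow> bool"
  where "idempotent_below f x y \<longleftrightarrow> f x x = x \<and> f y y = y \<and> f x y = y"

lemma isomorphic_translation_class_sizes:
  assumes iso: "semigroup_isomorphic A f B g" and cl: "\<And>a b. a \<in> A \<Longrightarrow> b \<in> A \<Longrightarrow> f a b \<in> A"
  shows "related_set_sizes A (translation_equal A f) = related_set_sizes B (translation_equal B g)"
proof -
  obtain h where h: "bij_betw h A B" "\<forall>a\<in>A. \<forall>b\<in>A. h (f a b) = g (h a) (h b)"
    using iso unfolding semigroup_isomorphic_def by blast
  have inj: "h x = h y \<longleftrightarrow> x = y" if "x \<in> A" "y \<in> A" for x y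
    using h(1) that by (auto simp: bij_betw_def inj_on_def)
  have B: "B = h ` A" using h(1) by (simp add: bij_betw_def)
  show ?thesis
    by (rule related_set_sizes_cong[OF h(1)])
      (use h(2) cl inj in \<open>auto simp: translation_equal_def B simp flip: h(2)[rule_format]\<close>)
qed

lemma isomorphic_idempotent_downset_sizes:
  assumes iso: "semigroup_isomorphic A f B g" and cl: "\<And>a b. a \<in> A \<Longrightarrow> b \<in> A \<Longrightarrow> f a b \<in> A"
  shows "related_set_sizes A (idempotent_below f) = related_set_sizes B (idempotent_below g)"
proof -
  obtain h where h: "bij_betw h A B" "\<forall>a\<in>A. \<forall>b\<in>A. h (f a b) = g (h a) (h b)"
    using iso unfolding semigroup_isomorphic_def by blast
  have inj: "h x = h y \<longleftrightarrow> x = y" if "x \<in> A" "y \<in> A" for x y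
    using h(1) that by (auto simp: bij_betw_def inj_on_def)
  show ?thesis
    by (rule related_set_sizes_cong[OF h(1)])
      (use cl inj in \<open>simp add: idempotent_below_def flip: h(2)[rule_format]\<close>)
qed

lemma power_mult_UNIV: "power_mult m UNIV f g = (\<lambda>x. m (f x) (g x))"
  unfolding power_mult_def by auto

text \<open>
  The constant functions make every projection surjective.
\<close>

lemma subdirect_power_UNIV_I:
  assumes "range (\<lambda>s _. s) \<subseteq> T" "\<And>f g. f \<in> T \<Longrightarrow> g \<in> T \<Longrightarrow> power_mult m UNIV f g \<in> T"
  shows "subdirect_power m UNIV T"
proof -
  have "s \<in> {f x |f. f \<in> T}" for s x
    by (rule CollectI, rule exI[of _ "\<lambda>_. s"]) (use assms(1) in auto)
  then show ?thesis using assms unfolding subdirect_power_def direct_power_def by auto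
qed

section \<open>Two comparable idempotents\<close>

text \<open>
  Let \<open>z\<close> be the least idempotent and \<open>e\<close> minimal among the others.  The functions \<open>chi A s\<close>
  below multiply like pairs \<open>(A, s)\<close> under intersection
  of the sets.  Together with the constants they form a subdirect power whose idempotents are, apart from
  finitely many constants, just the \<open>chi A e\<close>, so its semilattice of idempotents is essentially the
  chosen family of sets.  The family consists of the empty set, all singletons and one block of prescribed size
  for each \<open>n \<in> M\<close>; the sizes of the downsets of the blocks reveal \<open>M\<close>.
\<close>

lemma continuum_lepoll_if_two_idempotents:
  fixes m :: "'a \<Rightarrow> 'a \<Rightarrow> 'a"
  assumes fin: "finite (UNIV :: 'a set)" and sg: "abel_semigroup m" and inf: "infinite (UNIV :: 'i set)"
    and z: "m z z = z" "\<And>i. m i i = i \<Longrightarrow> m z i = z"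
    and e: "m e e = e" "e \<noteq> z" "\<And>i. m i i = i \<Longrightarrow> m e i = i \<Longrightarrow> i = e \<or> i = z"
  shows "(UNIV :: (nat \<Rightarrow> bool) set) \<lesssim> (subdirect_power_iso_types m :: ('i set \<times> ('i \<Rightarrow> 'a) set) set set)"
proof -
  interpret abel_semigroup m by (rule sg)
  note ac = assoc commute left_commute
  define c where "c = card (UNIV :: 'a set)"
  \<comment> \<open>The summand \<open>c\<close> makes the downset of a block larger than any set of constants.\<close>
  define block where "block n = {n} \<times> {..n + c}" for n :: nat
  define sets where "sets M = {A. A = {} \<or> (\<exists>a. A = {a}) \<or> (\<exists>n\<in>M. A = block n)}" for M
  define chi where "chi A s = (\<lambda>i :: nat \<times> nat. if i \<in> A then s else m z s)" for A s
  define T where "T M = range (\<lambda>s _. s) \<union> {chi A s | A s. A \<in> sets M \<and> m e s = s}" for M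
  let ?mm = "power_mult m (UNIV :: (nat \<times> nat) set)"
  have ze: "m z e = z" using z(2) e(1) .
  have block_Int: "block n \<inter> block n' = {}" if "n \<noteq> n'" for n n'
    using that unfolding block_def by auto
  have card_block: "card (block n) = n + c + 1" "finite (block n)" for n
    unfolding block_def by (simp_all add: card_cartesian_product)
  have sets_Int: "A \<inter> B \<in> sets M" if A: "A \<in> sets M" and B: "B \<in> sets M" for A B M
  proof (cases "\<exists>n\<in>M. \<exists>n'\<in>M. A = block n \<and> B = block n'")
    case True
    then obtain n n' where n: "n \<in> M" "A = block n" "B = block n'" by blast
    then show ?thesis using block_Int[of n n'] unfolding sets_def by (cases "n = n'") auto
  next
    case False
    then have "(\<exists>a. A \<subseteq> {a}) \<or> (\<exists>b. B \<subseteq> {b})" using A B unfolding sets_def by blast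
    then obtain a where "A \<inter> B \<subseteq> {a}" by blast
    then show ?thesis unfolding sets_def by (auto dest: subset_singletonD)
  qed
  have sets_fin: "finite A" if "A \<in> sets M" for A M
    using that card_block unfolding sets_def by auto
  have mult_chi: "?mm (chi A s) (chi B t) = chi (A \<inter> B) (m s t)" for A B s t
  proof -
    have "m (m z s) (m z t) = m z (m s t)" using z(1) by (metis ac)
    then show ?thesis unfolding power_mult_UNIV chi_def by (auto simp: ac)
  qed
  have mult_const: "?mm (\<lambda>_. s) (chi A t) = chi A (m s t)" "?mm (chi A t) (\<lambda>_. s) = chi A (m s t)" for A s t
    unfolding power_mult_UNIV chi_def by (auto simp: ac)
  have const_T: "(\<lambda>_. s) \<in> T M" for s M unfolding T_def by blast
  have chi_T: "chi A s \<in> T M" if "A \<in> sets M" "m e s = s" for A s M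
    using that unfolding T_def by blast
  have T_cases: "(\<exists>s. f = (\<lambda>_. s)) \<or> (\<exists>A s. f = chi A s \<and> A \<in> sets M \<and> m e s = s)" if "f \<in> T M" for f M
    using that unfolding T_def by blast
  have closed: "?mm f g \<in> T M" if f: "f \<in> T M" and g: "g \<in> T M" for f g M
  proof -
    have est: "m e (m s t) = m s t" if "m e s = s \<or> m e t = t" for s t
      using that by (metis assoc commute)
    show ?thesis
      using T_cases[OF f] T_cases[OF g]
    proof (elim disjE exE conjE)
      fix s t assume "f = (\<lambda>_. s)" "g = (\<lambda>_. t)"
      then show ?thesis using const_T[of "m s t" M] by (simp add: power_mult_UNIV)
    qed (auto simp: mult_chi mult_const intro!: chi_T sets_Int est)
  qed
  have sub: "subdirect_power m UNIV (T M)" for M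
    by (rule subdirect_power_UNIV_I) (use const_T closed in auto)
  have "countable (sets M)" for M
    by (rule countable_subset[OF _ countable_Collect_finite]) (use sets_fin in auto)
  then have "countable ((\<lambda>(A, s). chi A s) ` (sets M \<times> UNIV))" for M
    using fin by (intro countable_image countable_SIGMA) (auto intro: countable_finite)
  moreover have "countable (range (\<lambda>s _ :: nat \<times> nat. s :: 'a))"
    using fin by (intro countable_image countable_finite)
  ultimately have "countable (range (\<lambda>s _. s) \<union> (\<lambda>(A, s). chi A s) ` (sets M \<times> UNIV))" for M
    by blast
  then have cnt: "countable (T M)" for M
    by (rule countable_subset[rotated]) (auto simp: T_def)
  have chi_empty: "chi {} e = (\<lambda>_. z)" unfolding chi_def using ze by simp
  have idem: "(\<exists>i. y = (\<lambda>_. i) \<and> m i i = i) \<or> (\<exists>A. y = chi A e \<and> A \<in> sets M \<and> A \<noteq> {})"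
    if y: "y \<in> T M" "?mm y y = y" for y M
    using T_cases[OF y(1)]
  proof (elim disjE exE conjE)
    fix s assume "y = (\<lambda>_. s)"
    moreover then have "m s s = s" using fun_cong[OF y(2)] by (simp add: power_mult_UNIV)
    ultimately show ?thesis by blast
  next
    fix A s assume A: "y = chi A s" "A \<in> sets M" "m e s = s"
    show ?thesis
    proof (cases "A = {}")
      case True
      then have "y = (\<lambda>_. m z s)" using A unfolding chi_def by simp
      moreover then have "m (m z s) (m z s) = m z s"
        using fun_cong[OF y(2)] by (simp add: power_mult_UNIV)
      ultimately show ?thesis by blast
    next
      case False
      then obtain a where "a \<in> A" by blast
      then have "m s s = s" using fun_cong[OF y(2), of a] A unfolding power_mult_UNIV chi_def by simp
      then have "s = e \<or> s = z" using e(3) A(3) by blast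
      then show ?thesis
      proof
        assume "s = z"
        then have "y = (\<lambda>_. z)" unfolding A(1) chi_def using z(1) by auto
        then show ?thesis using z(1) by blast
      qed (use A False in blast)
    qed
  qed
  let ?down = "\<lambda>M x. {y \<in> T M. idempotent_below ?mm x y}"
  have inj_chi: "inj (\<lambda>A. chi A e)"
  proof (rule injI)
    fix A B assume "chi A e = chi B e"
    then have "i \<in> A \<longleftrightarrow> i \<in> B" for i using fun_cong[of "chi A e" "chi B e" i] e(2) ze
      unfolding chi_def by (auto split: if_splits)
    then show "A = B" by blast
  qed
  have down_chi: "?down M (chi B e) = (\<lambda>A. chi A e) ` {A \<in> sets M. A \<subseteq> B}" if B: "B \<in> sets M" for B M
  proof (intro equalityI subsetI)
    fix y assume "y \<in> ?down M (chi B e)"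
    then have y: "y \<in> T M" "?mm y y = y" "?mm (chi B e) y = y" unfolding idempotent_below_def by auto
    have "infinite (UNIV :: (nat \<times> nat) set)" by (simp add: finite_prod)
    then obtain x where x: "x \<notin> B" using sets_fin[OF B] by (metis UNIV_eq_I)
    from idem[OF y(1,2)] show "y \<in> (\<lambda>A. chi A e) ` {A \<in> sets M. A \<subseteq> B}"
    proof (elim disjE exE conjE)
      fix i assume i: "y = (\<lambda>_. i)" "m i i = i"
      then have "m z i = i"
        using fun_cong[OF y(3), of x] x ze unfolding power_mult_UNIV chi_def by simp
      then have "y = chi {} e" using z(2) i chi_empty by simp
      then show ?thesis unfolding sets_def by blast
    next
      fix A assume A: "y = chi A e" "A \<in> sets M"
      have "a \<in> B" if "a \<in> A" for a
        using fun_cong[OF y(3), of a] that e(2) ze unfolding power_mult_UNIV chi_def A(1)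
        by (auto split: if_splits)
      then show ?thesis using A by blast
    qed
  next
    fix y assume "y \<in> (\<lambda>A. chi A e) ` {A \<in> sets M. A \<subseteq> B}"
    then obtain A where A: "y = chi A e" "A \<in> sets M" "A \<subseteq> B" by blast
    then have "B \<inter> A = A" by blast
    then show "y \<in> ?down M (chi B e)"
      using A e(1) chi_T[OF A(2) e(1)] by (simp add: idempotent_below_def mult_chi)
  qed
  have card_down: "card (?down M (chi B e)) = card {A \<in> sets M. A \<subseteq> B}"
    "finite (?down M (chi B e)) = finite {A \<in> sets M. A \<subseteq> B}" if "B \<in> sets M" for B M
    unfolding down_chi[OF that] using inj_chi
    by (auto intro!: card_image finite_image_iff inj_on_subset[OF inj_chi])
  have down_block: "card (?down M (chi (block n) e)) = n + c + 3 \<and> finite (?down M (chi (block n) e))"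
    if n: "n \<in> M" for n M
  proof -
    have B: "block n \<in> sets M" using n unfolding sets_def by blast
    have c1: "c > 0" unfolding c_def using fin by (simp add: card_gt_0_iff)
    have "block k \<subseteq> block n \<Longrightarrow> k = n" for k unfolding block_def by auto
    then have eq: "{A \<in> sets M. A \<subseteq> block n} = insert {} (insert (block n) ((\<lambda>a. {a}) ` block n))"
      using n unfolding sets_def by auto
    have "block n \<notin> (\<lambda>a. {a}) ` block n"
    proof
      assume "block n \<in> (\<lambda>a. {a}) ` block n"
      then have "card (block n) = 1" by auto
      then show False using card_block c1 by simp
    qed
    moreover have "card ((\<lambda>a. {a}) ` block n) = n + c + 1"
      using card_image[of "\<lambda>a. {a}" "block n"] card_block by simp
    moreover have "block n \<noteq> {}" using card_block(1)[of n] by force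
    moreover have "{} \<notin> (\<lambda>a. {a}) ` block n" by auto
    ultimately show ?thesis
      using card_block(2)[of n] unfolding card_down[OF B] eq by simp
  qed
  have sizes: "n + c + 3 \<in> related_set_sizes (T M) (idempotent_below ?mm) \<longleftrightarrow> n \<in> M" for n M
  proof
    assume "n \<in> M"
    then show "n + c + 3 \<in> related_set_sizes (T M) (idempotent_below ?mm)"
      unfolding related_set_sizes_def using down_block[of n M] chi_T[of "block n" M e] e(1)
      unfolding sets_def by (auto intro!: exI[of _ "chi (block n) e"])
  next
    assume "n + c + 3 \<in> related_set_sizes (T M) (idempotent_below ?mm)"
    then obtain x where x: "x \<in> T M" "finite (?down M x)" "card (?down M x) = n + c + 3"
      unfolding related_set_sizes_def by auto
    then have "?down M x \<noteq> {}" by force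
    then have "?mm x x = x" unfolding idempotent_below_def by blast
    from idem[OF x(1) this] show "n \<in> M"
    proof (elim disjE exE conjE)
      fix i assume i: "x = (\<lambda>_. i)" "m i i = i"
      \<comment> \<open>Otherwise all singletons would lie below the constant \<open>i\<close>.\<close>
      have "m i e \<noteq> e"
      proof
        assume "m i e = e"
        then have "chi {a} e \<in> ?down M x" for a
          using i e(1) chi_T[of "{a}" M e] unfolding sets_def
          by (simp add: idempotent_below_def mult_chi mult_const) (simp add: power_mult_UNIV)
        then have "(\<lambda>A. chi A e) ` range (\<lambda>a. {a}) \<subseteq> ?down M x" by blast
        then have "finite ((\<lambda>A. chi A e) ` range (\<lambda>a. {a}))" using x(2) finite_subset by blast
        then have "finite (range (\<lambda>a :: nat \<times> nat. {a}))"
          using finite_imageD inj_on_subset[OF inj_chi subset_UNIV] by blast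
        then show False using finite_imageD[of "\<lambda>a :: nat \<times> nat. {a}" UNIV] by (simp add: finite_prod)
      qed
      have "?down M x \<subseteq> range (\<lambda>s _. s)"
      proof
        fix y assume "y \<in> ?down M x"
        then have y: "y \<in> T M" "?mm y y = y" "?mm x y = y" unfolding idempotent_below_def by auto
        from idem[OF y(1,2)] show "y \<in> range (\<lambda>s _. s)"
        proof (elim disjE exE conjE)
          fix A assume A: "y = chi A e" "A \<noteq> {}"
          then obtain a where "a \<in> A" by blast
          then have "m i e = e"
            using fun_cong[OF y(3), of a] A i unfolding power_mult_UNIV chi_def by simp
          then show ?thesis using \<open>m i e \<noteq> e\<close> by blast
        qed blast
      qed
      then have "card (?down M x) \<le> card (range (\<lambda>s _ :: nat \<times> nat. s :: 'a))"
        using fin by (intro card_mono) auto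
      also have "\<dots> \<le> c" unfolding c_def by (rule card_image_le[OF fin])
      finally show ?thesis using x(3) by simp
    next
      fix A assume A: "x = chi A e" "A \<in> sets M" "A \<noteq> {}"
      then consider a where "A = {a}" | k where "k \<in> M" "A = block k" unfolding sets_def by blast
      then show ?thesis
      proof cases
        case 1
        have "{B \<in> sets M. B \<subseteq> A} \<subseteq> {{}, {a}}" using 1 by auto
        then have "card {B \<in> sets M. B \<subseteq> A} \<le> card {{}, {a}}" by (intro card_mono) auto
        then show ?thesis using x(3) card_down(1)[OF A(2)] A(1) by (simp add: card_insert_if)
      next
        case 2
        then show ?thesis using down_block[of k M] x(3) A(1) by simp
      qed
    qed
  qed
  have "M = M'" if "semigroup_isomorphic (T M) ?mm (T M') ?mm" for M M'
    using isomorphic_idempotent_downset_sizes[OF that closed] sizes by blast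
  then show ?thesis by (rule continuum_lepoll_iso_types[OF inf sub cnt])
qed

section \<open>A unique idempotent\<close>

lemma countable_eventually_constant:
  assumes "finite (UNIV :: 'a set)"
  shows "countable {f :: nat \<Rightarrow> 'a. \<exists>n v. \<forall>i\<ge>n. f i = v}"
proof (rule countable_subset)
  let ?g = "\<lambda>(xs, v) i. if i < length xs then xs ! i else v"
  show "countable (?g ` (lists (UNIV :: 'a set) \<times> UNIV))"
    using assms by (intro countable_image countable_SIGMA countable_lists countable_finite)
  show "{f :: nat \<Rightarrow> 'a. \<exists>n v. \<forall>i\<ge>n. f i = v} \<subseteq> ?g ` (lists UNIV \<times> UNIV)"
  proof clarify
    fix f :: "nat \<Rightarrow> 'a" and n v assume "\<forall>i\<ge>n. f i = v"
    then have "f = ?g (map f [0..<n], v)" by (auto simp: fun_eq_iff)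
    then show "f \<in> ?g ` (lists UNIV \<times> UNIV)" by (rule image_eqI) simp
  qed
qed

text \<open>
  The elements \<open>p\<close> and \<open>p'\<close> are twins: they have the same products with every element, while
  \<open>q\<close> differs from them in this respect.  For fixed \<open>n\<close> the functions
  \<open>x n j\<close> below differ only in the place where \<open>p'\<close> replaces \<open>p\<close>, so they are twins of each other in the
  power, and the place of \<open>q\<close> tells different \<open>n\<close> apart.  Adding the constants and the eventually constant functions with values in the ideal \<open>Q\<close> gives
  a subsemigroup, since every product that is not constant takes its values in \<open>Q\<close>.  The class of
  \<open>x n j\<close> has \<open>n + c + 1\<close> elements.  Every other class is infinite or has at most \<open>c\<close> elements:
  in the first alternative of the last assumption all functions with values in \<open>Q\<close> are twins, in the second one no
  two of them are.
\<close>

lemma continuum_lepoll_if_twins: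
  fixes m :: "'a \<Rightarrow> 'a \<Rightarrow> 'a"
  assumes fin: "finite (UNIV :: 'a set)" and sg: "abel_semigroup m" and inf: "infinite (UNIV :: 'i set)"
    and Q: "\<And>t s. t \<in> Q \<Longrightarrow> m t s \<in> Q" "p \<in> Q"
    and p': "p' \<noteq> p" "\<And>s. m p' s = m p s"
    and q: "\<And>s. m q s \<in> Q" "m q w \<noteq> m p w"
    and alt: "p' \<in> Q \<and> (\<forall>t\<in>Q. \<forall>s. m t s = m p s) \<or>
      q \<in> Q \<and> (\<forall>t\<in>Q. \<forall>t'\<in>Q. (\<forall>s. m t s = m t' s) \<longrightarrow> t = t')"
  shows "(UNIV :: (nat \<Rightarrow> bool) set) \<lesssim> (subdirect_power_iso_types m :: ('i set \<times> ('i \<Rightarrow> 'a) set) set set)"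
proof -
  interpret abel_semigroup m by (rule sg)
  let ?mm = "power_mult m (UNIV :: nat set)"
  define c where "c = card (UNIV :: 'a set) + 1"
  \<comment> \<open>For \<open>j = 0\<close> the first case prevails, so that \<open>p'\<close> does not occur in \<open>x n 0\<close>.\<close>
  define x where "x n j = (\<lambda>i. if i = n then q else if i = n + j then p' else p)" for n j :: nat
  define D where "D = {f :: nat \<Rightarrow> 'a. range f \<subseteq> Q \<and> (\<exists>n v. \<forall>i\<ge>n. f i = v)}"
  define T where "T M = range (\<lambda>s _. s) \<union> {x n j | n j. n \<in> M \<and> j \<le> n + c} \<union> D" for M
  define tw where "tw f g \<longleftrightarrow> (\<forall>i s. m (f i) s = m (g i) s)" for f g :: "nat \<Rightarrow> 'a"
  have x_ev: "\<forall>i\<ge>Suc (n + j). x n j i = p" for n j unfolding x_def by auto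
  have const_T: "(\<lambda>_. s) \<in> T M" for s M unfolding T_def by blast
  have T_ev: "\<exists>n v. \<forall>i\<ge>n. f i = v" if "f \<in> T M" for f M
    using that x_ev unfolding T_def D_def by blast
  have T_ideal: "(\<exists>s. f = (\<lambda>_. s)) \<or> (\<forall>i s. m (f i) s \<in> Q)" if "f \<in> T M" for f M
  proof -
    have "m (x n j i) s \<in> Q" for n j i s unfolding x_def using p' Q q by simp
    moreover have "m (d i) s \<in> Q" if "d \<in> D" for d i s
      using that Q(1) unfolding D_def by blast
    ultimately show ?thesis using that unfolding T_def by blast
  qed
  have closed: "?mm f g \<in> T M" if f: "f \<in> T M" and g: "g \<in> T M" for f g M
  proof (cases "(\<exists>s. f = (\<lambda>_. s)) \<and> (\<exists>t. g = (\<lambda>_. t))")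
    case True
    then show ?thesis using const_T unfolding power_mult_UNIV by auto
  next
    case False
    then have "m (f i) (g i) \<in> Q" for i using T_ideal[OF f] T_ideal[OF g] by (metis commute)
    moreover have "\<exists>n v. \<forall>i\<ge>n. m (f i) (g i) = v"
    proof -
      obtain a v b u where "\<forall>i\<ge>a. f i = v" "\<forall>i\<ge>b. g i = u" using T_ev f g by metis
      then have "\<forall>i\<ge>max a b. m (f i) (g i) = m v u" by simp
      then show ?thesis by blast
    qed
    ultimately have "?mm f g \<in> D" unfolding D_def power_mult_UNIV by blast
    then show ?thesis unfolding T_def by blast
  qed
  have sub: "subdirect_power m UNIV (T M)" for M
    by (rule subdirect_power_UNIV_I) (use const_T closed in auto)
  have cnt: "countable (T M)" for M
    by (rule countable_subset[OF _ countable_eventually_constant[OF fin]]) (use T_ev in blast)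
  have tw: "translation_equal (T M) ?mm f g \<longleftrightarrow> tw f g" for f g M
  proof
    assume te: "translation_equal (T M) ?mm f g"
    show "tw f g" unfolding tw_def
    proof (intro allI)
      fix i s
      have "?mm f (\<lambda>_. s) = ?mm g (\<lambda>_. s)" using te const_T unfolding translation_equal_def by blast
      then show "m (f i) s = m (g i) s" unfolding power_mult_UNIV by (rule fun_cong)
    qed
  qed (simp add: tw_def translation_equal_def power_mult_UNIV)
  let ?C = "\<lambda>M f. {g \<in> T M. tw f g}"
  have class_x: "?C M (x n j) = x n ` {..n + c}" if n: "n \<in> M" for M n j
  proof (intro equalityI subsetI)
    fix g assume "g \<in> x n ` {..n + c}"
    then show "g \<in> ?C M (x n j)" using n p'(2) unfolding T_def tw_def x_def by auto
  next
    fix g assume "g \<in> ?C M (x n j)"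
    then have g: "g \<in> T M" "\<And>i s. m (x n j i) s = m (g i) s" unfolding tw_def by auto
    have gn: "m q s = m (g n) s" for s using g(2)[of n s] unfolding x_def by simp
    from g(1) consider s where "g = (\<lambda>_. s)" | k l where "g = x k l" "k \<in> M" "l \<le> k + c" | "g \<in> D"
      unfolding T_def by blast
    then show "g \<in> x n ` {..n + c}"
    proof cases
      case (1 s)
      \<comment> \<open>A constant cannot be related both to \<open>q\<close> at \<open>n\<close> and to \<open>p\<close> beyond \<open>n + j\<close>.\<close>
      have "m p w = m s w" using g(2)[of "Suc (n + j)" w] unfolding 1 x_def by simp
      then show ?thesis using gn[of w] q(2) 1 by simp
    next
      case (2 k l)
      have "k = n"
      proof (rule ccontr)
        assume "k \<noteq> n"
        then have "m q w = m p w" using gn[of w] p'(2) unfolding 2 x_def by (simp split: if_splits)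
        then show False using q(2) by simp
      qed
      then show ?thesis using 2 by simp
    next
      case 3
      then have gQ: "g i \<in> Q" for i unfolding D_def by blast
      from alt show ?thesis
      proof
        assume "p' \<in> Q \<and> (\<forall>t\<in>Q. \<forall>s. m t s = m p s)"
        then show ?thesis using gn[of w] q(2) gQ by simp
      next
        assume a: "q \<in> Q \<and> (\<forall>t\<in>Q. \<forall>t'\<in>Q. (\<forall>s. m t s = m t' s) \<longrightarrow> t = t')"
        have "g i = x n 0 i" for i
        proof -
          have "x n 0 i \<in> Q" using a Q(2) unfolding x_def by simp
          moreover have "m (g i) s = m (x n 0 i) s" for s
            using g(2)[of i s] p'(2) unfolding x_def by (auto split: if_splits)
          ultimately show ?thesis using a gQ by blast
        qed
        then have "g = x n 0" by (rule ext)
        then show ?thesis by simp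
      qed
    qed
  qed
  have card_x: "card (x n ` {..n + c}) = n + c + 1" for n
  proof -
    have "inj_on (x n) {..n + c}"
    proof (rule inj_onI)
      fix j k assume "x n j = x n k"
      then have "x n j (n + j) = x n k (n + j)" "x n j (n + k) = x n k (n + k)" by simp_all
      then show "j = k" using p'(1) unfolding x_def by (auto split: if_splits)
    qed
    then show ?thesis by (simp add: card_image)
  qed
  have other: "card (?C M f) \<le> c"
    if f: "finite (?C M f)" and no: "\<And>n j. n \<in> M \<Longrightarrow> x n j \<notin> ?C M f" for M f
  proof -
    let ?K = "range (\<lambda>s _ :: nat. s :: 'a)"
    have K: "finite ?K" "card ?K \<le> card (UNIV :: 'a set)" using fin by (auto intro: card_image_le)
    have CKD: "?C M f \<subseteq> ?K \<union> (D \<inter> ?C M f)" using no unfolding T_def by blast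
    have "\<exists>d. D \<inter> ?C M f \<subseteq> {d}"
      using alt
    proof
      assume a: "p' \<in> Q \<and> (\<forall>t\<in>Q. \<forall>s. m t s = m p s)"
      have "D \<inter> ?C M f = {}"
      proof (rule ccontr)
        assume "D \<inter> ?C M f \<noteq> {}"
        then obtain d where d: "d \<in> D" "tw f d" by blast
        have "g \<in> ?C M f" if "g \<in> D" for g
        proof -
          have "d i \<in> Q" "g i \<in> Q" for i using that d(1) unfolding D_def by blast+
          then have "m (d i) s = m (g i) s" for i s using a by metis
          then have "tw f g" using d(2) unfolding tw_def by simp
          then show ?thesis using that unfolding T_def by blast
        qed
        then have "D \<subseteq> ?C M f" by (rule subsetI)
        then have finD: "finite D" using f by (rule finite_subset)
        have "(\<lambda>i. if i = n then p' else p) \<in> D" for n :: nat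
        proof -
          have "\<forall>i\<ge>Suc n. (if i = n then p' else p) = p" by simp
          then have "\<exists>k v. \<forall>i\<ge>k. (if i = n then p' else p) = v" by blast
          moreover have "range (\<lambda>i. if i = n then p' else p) \<subseteq> Q" using a Q(2) by auto
          ultimately show ?thesis unfolding D_def by blast
        qed
        then have "range (\<lambda>n i :: nat. if i = n then p' else p) \<subseteq> D" by blast
        then have "finite (range (\<lambda>n i :: nat. if i = n then p' else p))"
          using finD by (rule finite_subset)
        moreover have "inj (\<lambda>n i :: nat. if i = n then p' else p)"
        proof (rule injI)
          fix n k :: nat assume "(\<lambda>i. if i = n then p' else p) = (\<lambda>i. if i = k then p' else p)"
          from fun_cong[OF this, of n] show "n = k" using p'(1) by (auto split: if_splits)
        qed
        ultimately show False using finite_imageD infinite_UNIV_nat by blast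
      qed
      then show ?thesis by blast
    next
      assume a: "q \<in> Q \<and> (\<forall>t\<in>Q. \<forall>t'\<in>Q. (\<forall>s. m t s = m t' s) \<longrightarrow> t = t')"
      have "d = d'" if "d \<in> D" "d' \<in> D" "tw f d" "tw f d'" for d d'
      proof
        fix i
        have "d i \<in> Q" "d' i \<in> Q" using that unfolding D_def by blast+
        moreover have "m (d i) s = m (d' i) s" for s using that unfolding tw_def by metis
        ultimately show "d i = d' i" using a by blast
      qed
      then show ?thesis by blast
    qed
    then obtain d where "?C M f \<subseteq> insert d ?K" using CKD by blast
    then have "card (?C M f) \<le> card (insert d ?K)" using K by (intro card_mono) auto
    also have "\<dots> \<le> c" using K card_insert_le_m1[of c ?K d] unfolding c_def by simp
    finally show ?thesis .
  qed
  have sizes: "n + c + 1 \<in> related_set_sizes (T M) (translation_equal (T M) ?mm) \<longleftrightarrow> n \<in> M" for n M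
  proof
    assume n: "n \<in> M"
    then have "x n 0 \<in> T M" unfolding T_def by blast
    then show "n + c + 1 \<in> related_set_sizes (T M) (translation_equal (T M) ?mm)"
      unfolding related_set_sizes_def tw using class_x[OF n, of 0] card_x[of n]
      by (auto intro!: exI[of _ "x n 0"])
  next
    assume "n + c + 1 \<in> related_set_sizes (T M) (translation_equal (T M) ?mm)"
    then obtain f where f: "f \<in> T M" "finite (?C M f)" "card (?C M f) = n + c + 1"
      unfolding related_set_sizes_def tw by auto
    then have "\<not> card (?C M f) \<le> c" by simp
    then obtain k j where k: "k \<in> M" "x k j \<in> ?C M f" using other[OF f(2)] by blast
    then have "tw f g \<longleftrightarrow> tw (x k j) g" for g unfolding tw_def by simp
    then have "?C M f = ?C M (x k j)" by simp
    then have "k = n" using class_x[OF k(1), of j] card_x[of k] f(3) by simp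
    then show "n \<in> M" using k(1) by simp
  qed
  have "M = M'" if "semigroup_isomorphic (T M) ?mm (T M') ?mm" for M M'
    using isomorphic_translation_class_sizes[OF that closed] sizes by blast
  then show ?thesis by (rule continuum_lepoll_iso_types[OF inf sub cnt])
qed

section \<open>Ideals and idempotents of a finite commutative semigroup\<close>

text \<open>
  If \<open>a A\<close> is smaller than \<open>A\<close>, pass to it.  Otherwise \<open>a\<close> has local identities in \<open>A\<close>, and these
  form a subsemigroup: either it is smaller, or it is \<open>A\<close> and contains \<open>a\<close> itself.
\<close>

lemma (in abel_semigroup) idempotent_in_finite_subsemigroup:
  assumes "finite A" "A \<noteq> {}" "\<forall>x\<in>A. \<forall>y\<in>A. f x y \<in> A"
  shows "\<exists>z\<in>A. f z z = z"
  using assms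
proof (induction A rule: finite_psubset_induct)
  case (psubset A)
  then obtain a where a: "a \<in> A" by blast
  have sub: "f a ` A \<subseteq> A" using a psubset.prems by blast
  show ?case
  proof (cases "f a ` A = A")
    case False
    have "\<exists>z\<in>f a ` A. f z z = z"
    proof (rule psubset.IH)
      have "f (f a x) (f a y) = f a (f (f a x) y)" for x y by (simp add: ac_simps)
      then show "\<forall>x\<in>f a ` A. \<forall>y\<in>f a ` A. f x y \<in> f a ` A"
        using a psubset.prems by auto
    qed (use sub False a in auto)
    then show ?thesis using sub by blast
  next
    case True
    let ?B = "{x \<in> A. f a x = a}"
    have B: "?B \<noteq> {}" "\<forall>x\<in>?B. \<forall>y\<in>?B. f x y \<in> ?B"
      using True a psubset.prems by (auto simp flip: assoc) (metis imageE)
    show ?thesis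
    proof (cases "?B = A")
      case True
      then show ?thesis using a by blast
    next
      case False
      then have "\<exists>z\<in>?B. f z z = z" using psubset.IH[of ?B] B by blast
      then show ?thesis by blast
    qed
  qed
qed

text \<open>
  An idempotent strictly below \<open>i\<close> generates a strictly smaller principal ideal, so one with a
  smallest principal ideal is minimal.
\<close>

lemma (in abel_semigroup) exists_minimal_idempotent:
  assumes fin: "finite (UNIV :: 'a set)" and "f a a = a" "P a"
  obtains e where "f e e = e" "P e" "\<And>i. f i i = i \<Longrightarrow> P i \<Longrightarrow> f e i = i \<Longrightarrow> i = e"
proof -
  obtain e where e: "f e e = e" "P e"
    and min: "\<And>i. f i i = i \<Longrightarrow> P i \<Longrightarrow> card (range (f e)) \<le> card (range (f i))"
    using ex_has_least_nat[of "\<lambda>e. f e e = e \<and> P e" a "\<lambda>e. card (range (f e))"] assms by blast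
  have "i = e" if i: "f i i = i" "P i" "f e i = i" for i
  proof -
    have "range (f i) \<subseteq> range (f e)" using i(3) by (metis assoc image_subsetI rangeI)
    then have "range (f i) = range (f e)"
      using min[OF i(1,2)] fin by (intro card_seteq) (auto intro: finite_subset)
    then obtain s where "f i s = e" using e(1) by (metis rangeE rangeI)
    then have "f i e = e" using i(1) by (metis assoc)
    then show ?thesis using i(3) commute by metis
  qed
  then show ?thesis using that e by blast
qed

text \<open>
  Choose \<open>u\<close> outside \<open>J\<close> with a smallest principal ideal.  If \<open>u s\<close> were outside \<open>J\<close>, it would
  generate the same ideal, so \<open>u = u r\<close> for some \<open>r\<close>.  Such \<open>r\<close> form a subsemigroup, whose idempotent
  can only be \<open>z\<close>, and \<open>u = u z\<close> lies in \<open>J\<close>.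
\<close>

lemma (in abel_semigroup) exists_outside_ideal_absorbed:
  assumes fin: "finite (UNIV :: 'a set)" and uniq: "\<And>i. f i i = i \<Longrightarrow> i = z"
    and J: "\<And>t s. t \<in> J \<Longrightarrow> f t s \<in> J" "z \<in> J" "J \<noteq> UNIV"
  obtains u where "u \<notin> J" "\<And>s. f u s \<in> J"
proof -
  obtain a where "a \<notin> J" using J(3) by blast
  then obtain u where u: "u \<notin> J"
    and min: "\<And>v. v \<notin> J \<Longrightarrow> card (insert u (range (f u))) \<le> card (insert v (range (f v)))"
    using ex_has_least_nat[of "\<lambda>u. u \<notin> J" a "\<lambda>u. card (insert u (range (f u)))"] by blast
  have "f u s \<in> J" for s
  proof (rule ccontr)
    assume v: "f u s \<notin> J"
    have "insert (f u s) (range (f (f u s))) \<subseteq> insert u (range (f u))" by (auto simp: assoc)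
    then have "insert (f u s) (range (f (f u s))) = insert u (range (f u))"
      using min[OF v] fin by (intro card_seteq) (auto intro: finite_subset)
    then have "u \<in> insert (f u s) (range (f (f u s)))" by blast
    then obtain r where r: "f u r = u" by (metis assoc insertE rangeE)
    have "\<exists>r\<in>{r. f u r = u}. f r r = r"
      by (rule idempotent_in_finite_subsemigroup)
        (use r fin in \<open>auto intro: finite_subset simp flip: assoc\<close>)
    then have "f u z = u" using uniq by blast
    then show False using u J(1)[OF J(2), of u] commute by metis
  qed
  then show ?thesis using that u by blast
qed

section \<open>Semigroups that are neither groups nor null\<close>

text \<open>
  Let \<open>z\<close> be the only idempotent.  Then \<open>K = z S\<close> is a group, properly contained in \<open>S\<close>, and some \<open>u\<close>
  outside \<open>K\<close> satisfies \<open>u S \<subseteq> K\<close>.  If \<open>K\<close> is not trivial, \<open>u\<close> and \<open>z u\<close> are twins, and \<open>q\<close> is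
  any other element \<open>g z u\<close> of the group.  If \<open>K\<close> is trivial, \<open>z\<close> is a zero, and its twins form the annihilator
  \<open>P\<close> of \<open>S\<close>.  As \<open>S\<close> is not null, \<open>P\<close> is a proper ideal; an element \<open>q\<close> outside \<open>P\<close> with
  \<open>q S \<subseteq> P\<close> has a non-zero product \<open>q w\<close>, and this is a twin of \<open>z\<close>.
\<close>

theorem continuum_lepoll_iso_types_if_not_group_not_null:
  fixes m :: "'a \<Rightarrow> 'a \<Rightarrow> 'a"
  assumes fin: "finite (UNIV :: 'a set)" and sg: "abel_semigroup m" and inf: "infinite (UNIV :: 'i set)"
    and ng: "\<not> is_abelian_group m" and nn: "\<not> null_semigroup m"
  shows "(UNIV :: (nat \<Rightarrow> bool) set) \<lesssim> (subdirect_power_iso_types m :: ('i set \<times> ('i \<Rightarrow> 'a) set) set set)"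
proof -
  interpret abel_semigroup m by (rule sg)
  obtain a where "m a a = a" using idempotent_in_finite_subsemigroup[of UNIV] fin by blast
  then obtain z where z: "m z z = z" "\<And>i. m i i = i \<Longrightarrow> m z i = i \<Longrightarrow> i = z"
    by (rule exists_minimal_idempotent[OF fin, where P = "\<lambda>_. True"]) auto
  have z0: "m z i = z" if "m i i = i" for i
  proof (rule z(2))
    show "m (m z i) (m z i) = m z i" using that z(1) by (metis assoc left_commute)
    show "m z (m z i) = m z i" using z(1) by (metis assoc)
  qed
  show ?thesis
  proof (cases "\<exists>b. m b b = b \<and> b \<noteq> z")
    case True
    then obtain b where "m b b = b" "b \<noteq> z" by blast
    then obtain e where "m e e = e" "e \<noteq> z" "\<And>i. m i i = i \<Longrightarrow> i \<noteq> z \<Longrightarrow> m e i = i \<Longrightarrow> i = e"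
      by (rule exists_minimal_idempotent[OF fin, where P = "\<lambda>i. i \<noteq> z"]) auto
    then show ?thesis
      by (intro continuum_lepoll_if_two_idempotents[OF fin sg inf z(1) z0, of e]) auto
  next
    case False
    then have uniq: "i = z" if "m i i = i" for i using that by blast
    define K where "K = range (m z)"
    have zK: "m z t = t" if "t \<in> K" for t using that z(1) unfolding K_def by (auto simp flip: assoc)
    have K: "m t s \<in> K" if "t \<in> K" for t s using that unfolding K_def by (auto simp: assoc)
    have zinK: "z \<in> K" using z(1) unfolding K_def by (metis rangeI)
    have inv: "\<exists>y. m x y = z" for x
    proof -
      have "\<exists>i\<in>range (m x). m i i = i"
        by (rule idempotent_in_finite_subsemigroup) (use fin in \<open>auto simp: assoc\<close>)
      then show ?thesis using uniq by auto
    qed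
    have "K \<noteq> UNIV"
    proof
      assume "K = UNIV"
      then have one: "m z x = x" for x using zK by blast
      obtain i where "\<And>x. m x (i x) = z" using inv by metis
      then have "group m z i" by unfold_locales (use one commute in metis)+
      then show False using ng sg unfolding is_abelian_group_def by blast
    qed
    then obtain u where u: "u \<notin> K" "\<And>s. m u s \<in> K"
      using exists_outside_ideal_absorbed[OF fin uniq K zinK] by blast
    show ?thesis
    proof (cases "K = {z}")
      case False
      then obtain g where g: "g \<in> K" "g \<noteq> z" using zinK by blast
      obtain w where w: "m u w = z" using inv by blast
      let ?p = "m z u"
      have pK: "?p \<in> K" unfolding K_def by blast
      have us: "m u s = m ?p s" for s using zK[OF u(2)[of s]] by (simp add: assoc)
      have q: "m (m g ?p) w = g" "m ?p w = z"
        using zK[OF g(1)] w z(1) by (metis assoc commute)+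
      show ?thesis
      proof (rule continuum_lepoll_if_twins[OF fin sg inf K pK, of u "m g ?p" w])
        show "u \<noteq> ?p" using u(1) pK by metis
        show "m (m g ?p) s \<in> K" for s using K g(1) by (simp add: assoc)
        show "m (m g ?p) w \<noteq> m ?p w" using q g(2) by simp
        have "t = t'" if "t \<in> K" "t' \<in> K" "\<forall>s. m t s = m t' s" for t t'
          using that zK commute by metis
        then show "u \<in> K \<and> (\<forall>t\<in>K. \<forall>s. m t s = m ?p s) \<or>
          m g ?p \<in> K \<and> (\<forall>t\<in>K. \<forall>t'\<in>K. (\<forall>s. m t s = m t' s) \<longrightarrow> t = t')"
          using K g(1) by blast
      qed (use us in auto)
    next
      case True
      have zero: "m z s = z" for s using True unfolding K_def by blast
      define P where "P = {t. \<forall>s. m t s = z}"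
      have PI: "m t s \<in> P" if "t \<in> P" for t s using that zero unfolding P_def by (simp add: assoc)
      have zP: "z \<in> P" unfolding P_def using zero by simp
      have "P \<noteq> UNIV"
      proof
        assume "P = UNIV"
        then have "m s t = z" for s t unfolding P_def by blast
        then show False using nn semigroup_axioms unfolding null_semigroup_def by blast
      qed
      then obtain q where q: "q \<notin> P" "\<And>s. m q s \<in> P"
        using exists_outside_ideal_absorbed[OF fin uniq PI zP] by blast
      then obtain w where w: "m q w \<noteq> z" unfolding P_def by blast
      show ?thesis
        by (rule continuum_lepoll_if_twins[OF fin sg inf PI zP, of "m q w" q w])
          (use q(2) w zero in \<open>auto simp: P_def\<close>)
    qed
  qed
qed

theorem mainTheorem1:
  fixes m :: "'a \<Rightarrow> 'a \<Rightarrow> 'a"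
  assumes "finite (UNIV :: 'a set)"
    and "abel_semigroup m"
    and "infinite (UNIV :: 'i set)"
  shows "(countable (subdirect_power_iso_types m :: ('i set \<times> ('i \<Rightarrow> 'a) set) set set) \<longleftrightarrow>
            is_abelian_group m \<or> null_semigroup m) \<and>
         (\<not> is_abelian_group m \<and> \<not> null_semigroup m \<longrightarrow>
            (subdirect_power_iso_types m :: ('i set \<times> ('i \<Rightarrow> 'a) set) set set)
              \<approx> (UNIV :: (nat \<Rightarrow> bool) set))"
proof -
  let ?I = "subdirect_power_iso_types m :: ('i set \<times> ('i \<Rightarrow> 'a) set) set set"
  have small: "countable ?I" if "is_abelian_group m \<or> null_semigroup m"
    using that countable_iso_types_group[OF assms(1)] countable_iso_types_null by blast
  have large: "?I \<approx> (UNIV :: (nat \<Rightarrow> bool) set)" if "\<not> is_abelian_group m" "\<not> null_semigroup m"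
    using iso_types_lepoll_continuum continuum_lepoll_iso_types_if_not_group_not_null[OF assms that]
    by (rule lepoll_antisym)
  have "uncountable (UNIV :: (nat \<Rightarrow> bool) set)"
  proof
    assume "countable (UNIV :: (nat \<Rightarrow> bool) set)"
    then obtain g :: "nat \<Rightarrow> nat \<Rightarrow> bool" where "range g = UNIV"
      using uncountable_def[of "UNIV :: (nat \<Rightarrow> bool) set"] by auto
    then obtain n where "g n = (\<lambda>k. \<not> g k k)" by (metis rangeE UNIV_I)
    then show False by (metis (full_types))
  qed
  then have "uncountable ?I" if "?I \<approx> (UNIV :: (nat \<Rightarrow> bool) set)"
    using countable_eqpoll eqpoll_sym that by blast
  then show ?thesis using small large by blast
qed

end
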